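(* Let $m>1$ be an integer. There is no one-to-one homogeneous harmonic polynomial mapping $P:\mathbb{R}^3\to\mathbb{R}^3$ of degree $m$.
   Context: A homogeneous harmonic polynomial mapping of degree $m$ is a map all of whose components are homogeneous polynomials of degree $m$ that are harmonic with respect to the Euclidean Laplacian. *)

theory Defs
  imports "HOL-Analysis.Analysis"
begin

definition multi_indices :: "nat \<Rightarrow> ('n::finite \<Rightarrow> nat) set"
  where "multi_indices m = {\<alpha>. (\<Sum>i\<in>UNIV. \<alpha> i) = m}"

text \<open>Needed so that the sum in the next definition is not the default value \<open>0\<close>.\<close>

lemma finite_multi_indices: "finite (multi_indices m :: ('n::finite \<Rightarrow> nat) set)"
proof (rule finite_subset)
  show "multi_indices m \<subseteq> PiE (UNIV :: 'n set) (\<lambda>_. {..m})"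
    by (auto simp: multi_indices_def PiE_def extensional_def intro: member_le_sum)
  show "finite (PiE (UNIV :: 'n set) (\<lambda>_. {..m}))"
    by (intro finite_PiE) auto
qed

text \<open>As usual, the zero polynomial counts as homogeneous of every degree.\<close>

definition homogeneous_polynomial :: "nat \<Rightarrow> (real ^ 'n \<Rightarrow> real) \<Rightarrow> bool"
  where "homogeneous_polynomial m f \<longleftrightarrow>
    (\<exists>c :: ('n \<Rightarrow> nat) \<Rightarrow> real.
      \<forall>x. f x = (\<Sum>\<alpha>\<in>multi_indices m. c \<alpha> * (\<Prod>i\<in>UNIV. (x $ i) ^ \<alpha> i)))"

definition partial_deriv :: "'n \<Rightarrow> (real ^ 'n \<Rightarrow> real) \<Rightarrow> real ^ 'n \<Rightarrow> real"
  where "partial_deriv i f x = deriv (\<lambda>t. f (x + t *\<^sub>R axis i 1)) 0"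

text \<open>\<^const>\<open>deriv\<close> is unspecified where the derivative does not exist, so this is meaningful
  only for functions that are twice partially differentiable; here it is applied to
  polynomials only.\<close>

definition laplacian :: "(real ^ 'n \<Rightarrow> real) \<Rightarrow> real ^ 'n \<Rightarrow> real"
  where "laplacian f x = (\<Sum>i\<in>UNIV. partial_deriv i (partial_deriv i f) x)"

definition homogeneous_harmonic_polynomial :: "nat \<Rightarrow> (real ^ 'n \<Rightarrow> real) \<Rightarrow> bool"
  where "homogeneous_harmonic_polynomial m f \<longleftrightarrow>
    homogeneous_polynomial m f \<and> (\<forall>x. laplacian f x = 0)"

definition homogeneous_harmonic_polynomial_map :: "nat \<Rightarrow> (real ^ 'n \<Rightarrow> real ^ 'k) \<Rightarrow> bool"
  where "homogeneous_harmonic_polynomial_map m P \<longleftrightarrow>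
    (\<forall>j. homogeneous_harmonic_polynomial m (\<lambda>x. P x $ j))"

end

theory Submission
  imports Defs "HOL-Analysis.Cross3"
begin

text \<open>
  Let \<open>J\<close> be the Jacobian determinant of a homogeneous harmonic map \<open>P\<close> of degree \<open>m > 1\<close>.

  \<open>J\<close> has a zero on the unit sphere. Otherwise rotate a minimum point of \<open>\<bar>J\<bar>\<close> on the sphere to the pole.
  Since \<open>J\<close> is homogeneous of degree \<open>3 (m - 1)\<close>, minimality bounds the sum of the two tangential second
  derivatives of \<open>J\<close> from below, while harmonicity lets one compute this sum at a critical point,
  and it is too small: for \<open>J > 0\<close> the spherical Laplacian of \<open>ln J\<close> there is at most
  \<open>- (m - 1) (m + 2)\<close>.

  A zero of \<open>J\<close> excludes injectivity. By Euler's identity some component \<open>f = a \<bullet> P\<close> then vanishes to second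
  order at that point. The lowest-order part of \<open>f\<close> in the tangent plane is a planar
  harmonic form \<open>A r\<^sup>k cos (k \<theta> - \<alpha>)\<close> with \<open>k \<ge> 2\<close>, so zeros of \<open>f\<close> accumulate at the point
  in at least three sectors that are separated by rays without zeros. If \<open>P\<close> were injective, it would be
  a homeomorphism onto an open set, and near the point the zero set of \<open>f\<close> would be the cone over
  the preimage of a line segment, whose two halves meet only two sectors.
\<close>

subsection \<open>Homogeneous polynomials and rotations\<close>

lemma homogeneous_polynomial_zero: "homogeneous_polynomial m (\<lambda>x. 0)"
  unfolding homogeneous_polynomial_def by (rule exI[of _ "\<lambda>_. 0"]) simp

lemma homogeneous_polynomial_add:
  assumes "homogeneous_polynomial m f" "homogeneous_polynomial m g"
  shows "homogeneous_polynomial m (\<lambda>x. f x + g x)"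
proof -
  obtain c d where "\<forall>x. f x = (\<Sum>\<alpha>\<in>multi_indices m. c \<alpha> * (\<Prod>i\<in>UNIV. (x $ i) ^ \<alpha> i))"
    and "\<forall>x. g x = (\<Sum>\<alpha>\<in>multi_indices m. d \<alpha> * (\<Prod>i\<in>UNIV. (x $ i) ^ \<alpha> i))"
    using assms unfolding homogeneous_polynomial_def by blast
  then show ?thesis unfolding homogeneous_polynomial_def
    by (intro exI[of _ "\<lambda>\<alpha>. c \<alpha> + d \<alpha>"]) (simp add: distrib_right sum.distrib)
qed

lemma homogeneous_polynomial_cmult:
  assumes "homogeneous_polynomial m f"
  shows "homogeneous_polynomial m (\<lambda>x. a * f x)"
proof -
  obtain c where "\<forall>x. f x = (\<Sum>\<alpha>\<in>multi_indices m. c \<alpha> * (\<Prod>i\<in>UNIV. (x $ i) ^ \<alpha> i))"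
    using assms unfolding homogeneous_polynomial_def by blast
  then show ?thesis unfolding homogeneous_polynomial_def
    by (intro exI[of _ "\<lambda>\<alpha>. a * c \<alpha>"]) (simp add: sum_distrib_left mult.assoc)
qed

lemma homogeneous_polynomial_sum:
  assumes "finite S" "\<And>s. s \<in> S \<Longrightarrow> homogeneous_polynomial m (f s)"
  shows "homogeneous_polynomial m (\<lambda>x. \<Sum>s\<in>S. f s x)"
  using assms
  by (induction S rule: finite_induct)
     (auto intro: homogeneous_polynomial_zero homogeneous_polynomial_add)

lemma homogeneous_polynomial_monomial:
  assumes "\<alpha> \<in> multi_indices m"
  shows "homogeneous_polynomial m (\<lambda>x. \<Prod>i\<in>UNIV. (x $ i) ^ \<alpha> i)"
  unfolding homogeneous_polynomial_def
proof (intro exI allI)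
  fix x :: "real ^ 'a"
  show "(\<Prod>i\<in>UNIV. (x $ i) ^ \<alpha> i)
    = (\<Sum>\<beta>\<in>multi_indices m. (if \<beta> = \<alpha> then 1 else 0) * (\<Prod>i\<in>UNIV. (x $ i) ^ \<beta> i))"
    using assms by (simp add: if_distribR sum.delta' finite_multi_indices mult_if_delta cong: if_cong)
qed

text \<open>The degree condition is imposed only on terms with nonzero coefficient: differentiating
  a monomial that does not contain the variable gives a term of the wrong degree, but with
  coefficient 0.\<close>

lemma homogeneous_polynomial_lincomb:
  assumes "finite S" "\<And>s. s \<in> S \<Longrightarrow> d s \<noteq> 0 \<Longrightarrow> e s \<in> multi_indices m"
  shows "homogeneous_polynomial m (\<lambda>x. \<Sum>s\<in>S. d s * (\<Prod>i\<in>UNIV. (x $ i) ^ e s i))"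
proof (rule homogeneous_polynomial_sum[OF assms(1)])
  fix s assume "s \<in> S"
  then show "homogeneous_polynomial m (\<lambda>x. d s * (\<Prod>i\<in>UNIV. (x $ i) ^ e s i))"
    using assms(2)[of s]
    by (cases "d s = 0")
       (auto simp: homogeneous_polynomial_zero intro!: homogeneous_polynomial_cmult homogeneous_polynomial_monomial)
qed

lemma homogeneous_polynomial_mult_coord:
  assumes "homogeneous_polynomial m f"
  shows "homogeneous_polynomial (Suc m) (\<lambda>x. x $ k * f x)"
proof -
  obtain c where c: "\<And>x. f x = (\<Sum>\<alpha>\<in>multi_indices m. c \<alpha> * (\<Prod>i\<in>UNIV. (x $ i) ^ \<alpha> i))"
    using assms unfolding homogeneous_polynomial_def by blast
  have "homogeneous_polynomial (Suc m)
      (\<lambda>x. \<Sum>\<alpha>\<in>multi_indices m. c \<alpha> * (\<Prod>i\<in>UNIV. (x $ i) ^ (\<alpha>(k := Suc (\<alpha> k))) i))"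
    by (rule homogeneous_polynomial_lincomb[OF finite_multi_indices])
       (auto simp: multi_indices_def sum.remove[of UNIV k])
  also have "(\<lambda>x. \<Sum>\<alpha>\<in>multi_indices m. c \<alpha> * (\<Prod>i\<in>UNIV. (x $ i) ^ (\<alpha>(k := Suc (\<alpha> k))) i))
      = (\<lambda>x. x $ k * f x)"
    by (auto simp: c sum_distrib_left prod.remove[of UNIV k] intro!: sum.cong ext)
  finally show ?thesis .
qed

lemma homogeneous_polynomial_one: "homogeneous_polynomial 0 (\<lambda>x. 1)"
  using homogeneous_polynomial_monomial[of "\<lambda>_. 0" 0] by (simp add: multi_indices_def)

text \<open>Each \<open>(R *v x) $ i\<close> is a combination of coordinates, so multiplying by it
  raises the degree by one. Building the substituted monomials factor by factor avoids any
  multinomial expansion.\<close>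

lemma homogeneous_polynomial_compose_matrix:
  fixes R :: "real ^ 'n ^ 'n"
  assumes "homogeneous_polynomial m f"
  shows "homogeneous_polynomial m (\<lambda>x. f (R *v x))"
proof -
  obtain c where c: "\<And>x. f x = (\<Sum>\<alpha>\<in>multi_indices m. c \<alpha> * (\<Prod>i\<in>UNIV. (x $ i) ^ \<alpha> i))"
    using assms unfolding homogeneous_polynomial_def by blast
  have lin: "homogeneous_polynomial (Suc n) (\<lambda>x. (R *v x) $ i * g x)"
    if "homogeneous_polynomial n g" for n g i
  proof -
    have "homogeneous_polynomial (Suc n) (\<lambda>x. \<Sum>j\<in>UNIV. R $ i $ j * (x $ j * g x))"
      by (intro homogeneous_polynomial_sum homogeneous_polynomial_cmult
          homogeneous_polynomial_mult_coord that) auto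
    then show ?thesis
      by (simp add: matrix_vector_mult_def sum_distrib_right mult.assoc)
  qed
  have pow: "homogeneous_polynomial (k + n) (\<lambda>x. (R *v x) $ i ^ k * g x)"
    if "homogeneous_polynomial n g" for n g i k
    by (induction k) (use that lin in \<open>auto simp: mult.assoc\<close>)
  have mono: "homogeneous_polynomial (\<Sum>i\<in>I. \<alpha> i) (\<lambda>x. \<Prod>i\<in>I. (R *v x) $ i ^ \<alpha> i)"
    if "finite I" for I and \<alpha> :: "'n \<Rightarrow> nat"
    using that
    by (induction I rule: finite_induct) (auto intro: pow homogeneous_polynomial_one)
  show ?thesis unfolding c
  proof (intro homogeneous_polynomial_sum homogeneous_polynomial_cmult finite_multi_indices)
    fix \<alpha> :: "'n \<Rightarrow> nat" assume "\<alpha> \<in> multi_indices m"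
    then show "homogeneous_polynomial m (\<lambda>x. \<Prod>i\<in>UNIV. (R *v x) $ i ^ \<alpha> i)"
      using mono[of UNIV \<alpha>] by (simp add: multi_indices_def)
  qed
qed

lemma homogeneous_polynomial_scaleR:
  assumes "homogeneous_polynomial m f"
  shows "f (s *\<^sub>R x) = s ^ m * f x"
proof -
  obtain c where c: "\<And>x. f x = (\<Sum>\<alpha>\<in>multi_indices m. c \<alpha> * (\<Prod>i\<in>UNIV. (x $ i) ^ \<alpha> i))"
    using assms unfolding homogeneous_polynomial_def by blast
  have "(\<Prod>i\<in>UNIV. s ^ \<alpha> i) = s ^ m" if "\<alpha> \<in> multi_indices m" for \<alpha> :: "'a \<Rightarrow> nat"
    using that by (auto simp: multi_indices_def power_sum)
  then show ?thesis
    by (auto simp: c power_mult_distrib prod.distrib sum_distrib_left intro!: sum.cong)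
qed

lemma homogeneous_polynomial_differentiable:
  assumes "homogeneous_polynomial m f"
  shows "f differentiable (at x)"
proof -
  obtain c where c: "\<And>x. f x = (\<Sum>\<alpha>\<in>multi_indices m. c \<alpha> * (\<Prod>i\<in>UNIV. (x $ i) ^ \<alpha> i))"
    using assms unfolding homogeneous_polynomial_def by blast
  have "real_polynomial_function (\<lambda>x. x $ i)" for i :: 'a
    by (rule real_polynomial_function.intros(1)) (rule bounded_linear_vec_nth)
  then have "real_polynomial_function f"
    unfolding c by (intro real_polynomial_function_sum real_polynomial_function.intros(4)
        real_polynomial_function.intros(2) real_polynomial_function_prod
        real_polynomial_function_power finite_multi_indices) auto
  then show ?thesis by (rule differentiable_at_real_polynomial_function)
qed

lemma homogeneous_polynomial_continuous_on:
  "homogeneous_polynomial m f \<Longrightarrow> continuous_on S f"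
  by (meson continuous_at_imp_continuous_on differentiable_imp_continuous_within
      homogeneous_polynomial_differentiable)

section \<open>Partial derivatives of polynomials and rotation invariance of the Laplacian\<close>

lemma has_real_derivative_along:
  assumes "(f has_derivative f') (at x)"
  shows "((\<lambda>t. f (x + t *\<^sub>R v)) has_real_derivative f' v) (at 0)"
proof -
  have "((\<lambda>t. x + t *\<^sub>R v) has_derivative (\<lambda>t. t *\<^sub>R v)) (at 0)"
    by (auto intro!: derivative_eq_intros)
  then have "((\<lambda>t. f (x + t *\<^sub>R v)) has_derivative (\<lambda>t. f' (t *\<^sub>R v))) (at 0)"
    using has_derivative_compose[of "\<lambda>t. x + t *\<^sub>R v" _ 0 UNIV f f'] assms by simp
  moreover have "(\<lambda>t. f' (t *\<^sub>R v)) = (*) (f' v)"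
    using has_derivative_linear[OF assms] by (auto simp: linear_cmul)
  ultimately show ?thesis by (simp add: has_field_derivative_def)
qed

lemma partial_deriv_eq:
  assumes "(f has_derivative f') (at x)"
  shows "partial_deriv k f x = f' (axis k 1)"
  unfolding partial_deriv_def using has_real_derivative_along[OF assms] by (rule DERIV_imp_deriv)

lemma has_derivative_partial_deriv:
  fixes f :: "real ^ 'n \<Rightarrow> real"
  assumes "f differentiable (at x)"
  shows "(f has_derivative (\<lambda>h. \<Sum>k\<in>UNIV. h $ k * partial_deriv k f x)) (at x)"
proof -
  obtain f' where f': "(f has_derivative f') (at x)"
    using assms by (auto simp: differentiable_def)
  interpret linear f' using f' by (rule has_derivative_linear)
  have "f' h = (\<Sum>k\<in>UNIV. h $ k * partial_deriv k f x)" for h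
  proof -
    have "f' h = f' (\<Sum>k\<in>UNIV. h $ k *\<^sub>R axis k 1)"
      by (subst basis_expansion[of h, unfolded scalar_mult_eq_scaleR, symmetric]) simp
    also have "\<dots> = (\<Sum>k\<in>UNIV. h $ k * f' (axis k 1))"
      by (simp add: sum scale)
    finally show ?thesis by (simp add: partial_deriv_eq[OF f'])
  qed
  then have "f' = (\<lambda>h. \<Sum>k\<in>UNIV. h $ k * partial_deriv k f x)" by (rule ext)
  then show ?thesis using f' by simp
qed

lemma partial_deriv_sum_cmult:
  assumes "finite S" "\<And>s. s \<in> S \<Longrightarrow> f s differentiable (at x)"
  shows "partial_deriv k (\<lambda>x. \<Sum>s\<in>S. a s * f s x) x = (\<Sum>s\<in>S. a s * partial_deriv k (f s) x)"
proof -
  have "((\<lambda>x. \<Sum>s\<in>S. a s * f s x) has_derivative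
      (\<lambda>h. \<Sum>s\<in>S. a s * (\<Sum>k\<in>UNIV. h $ k * partial_deriv k (f s) x))) (at x)"
    by (intro has_derivative_sum has_derivative_mult_right has_derivative_partial_deriv assms)
  from partial_deriv_eq[OF this, of k] show ?thesis
    by (simp add: axis_def if_distribR if_distrib[of "\<lambda>x. x * _"] sum.delta' cong: if_cong)
qed

lemma partial_deriv_compose_matrix:
  fixes R :: "real ^ 'n ^ 'n"
  assumes "f differentiable (at (R *v x))"
  shows "partial_deriv i (\<lambda>x. f (R *v x)) x = (\<Sum>k\<in>UNIV. R $ k $ i * partial_deriv k f (R *v x))"
proof -
  have "((\<lambda>x. R *v x) has_derivative (\<lambda>x. R *v x)) (at x)"
    by (simp add: bounded_linear_imp_has_derivative)
  from has_derivative_compose[OF this has_derivative_partial_deriv[OF assms]]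
  show ?thesis by (simp add: partial_deriv_eq matrix_vector_mult_basis column_def)
qed

text \<open>The index set is arbitrary and detached from the exponents, so the formula can be
  iterated: after differentiation distinct indices may carry equal exponents. The truncated exponent
  \<open>e s k - 1\<close> at \<open>e s k = 0\<close> comes with the factor 0.\<close>

lemma partial_deriv_monomials:
  fixes e :: "'s \<Rightarrow> 'n::finite \<Rightarrow> nat"
  assumes "finite S"
  shows "partial_deriv k (\<lambda>x. \<Sum>s\<in>S. c s * (\<Prod>i\<in>UNIV. (x $ i) ^ e s i))
    = (\<lambda>x. \<Sum>s\<in>S. c s * e s k * (\<Prod>i\<in>UNIV. (x $ i) ^ ((e s)(k := e s k - 1)) i))"
proof
  fix x :: "real ^ 'n"
  have eq: "(\<Prod>i\<in>UNIV. ((x + t *\<^sub>R axis k 1) $ i) ^ e s i)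
      = (x $ k + t) ^ e s k * (\<Prod>i\<in>UNIV - {k}. (x $ i) ^ e s i)" for s t
    by (subst prod.remove[of _ k]) (auto simp: axis_def)
  have "((\<lambda>t. \<Sum>s\<in>S. c s * ((x $ k + t) ^ e s k * (\<Prod>i\<in>UNIV - {k}. (x $ i) ^ e s i)))
     has_real_derivative
      (\<Sum>s\<in>S. c s * e s k * (\<Prod>i\<in>UNIV. (x $ i) ^ ((e s)(k := e s k - 1)) i))) (at 0)"
    by (subst prod.remove[of _ k]) (auto intro!: derivative_eq_intros sum.cong)
  then show "partial_deriv k (\<lambda>x. \<Sum>s\<in>S. c s * (\<Prod>i\<in>UNIV. (x $ i) ^ e s i)) x
    = (\<Sum>s\<in>S. c s * e s k * (\<Prod>i\<in>UNIV. (x $ i) ^ ((e s)(k := e s k - 1)) i))"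
    unfolding partial_deriv_def eq by (rule DERIV_imp_deriv)
qed

lemma homogeneous_polynomial_partial_deriv:
  assumes "homogeneous_polynomial m f"
  shows "homogeneous_polynomial (m - 1) (partial_deriv k f)"
proof -
  obtain c where "\<forall>x. f x = (\<Sum>\<alpha>\<in>multi_indices m. c \<alpha> * (\<Prod>i\<in>UNIV. (x $ i) ^ \<alpha> i))"
    using assms unfolding homogeneous_polynomial_def by blast
  then have c: "f = (\<lambda>x. \<Sum>\<alpha>\<in>multi_indices m. c \<alpha> * (\<Prod>i\<in>UNIV. (x $ i) ^ \<alpha> i))" by auto
  show ?thesis unfolding c partial_deriv_monomials[OF finite_multi_indices]
    by (rule homogeneous_polynomial_lincomb[OF finite_multi_indices])
       (auto simp: multi_indices_def sum.remove[of UNIV k])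
qed

text \<open>Applying the chain rule twice produces the products
  \<open>R $ k $ i * R $ l $ i\<close>. Summed over \<open>i\<close> they give the Kronecker delta,
  because the rows of \<open>R\<close> are orthonormal, and only the pure second derivatives
  remain.\<close>

lemma laplacian_compose_orthogonal:
  fixes R :: "real ^ 'n ^ 'n"
  assumes f: "homogeneous_polynomial m f" and R: "orthogonal_matrix R"
  shows "laplacian (\<lambda>x. f (R *v x)) x = laplacian f (R *v x)"
proof -
  note hd = homogeneous_polynomial_differentiable
  note hp = homogeneous_polynomial_partial_deriv
  have 1: "partial_deriv i (\<lambda>x. f (R *v x)) = (\<lambda>x. \<Sum>k\<in>UNIV. R $ k $ i * partial_deriv k f (R *v x))" for i
    using partial_deriv_compose_matrix[OF hd[OF f]] by blast
  have 2: "partial_deriv i (\<lambda>x. \<Sum>k\<in>UNIV. R $ k $ i * partial_deriv k f (R *v x)) x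
     = (\<Sum>k\<in>UNIV. R $ k $ i * (\<Sum>l\<in>UNIV. R $ l $ i * partial_deriv l (partial_deriv k f) (R *v x)))" for i
    by (subst partial_deriv_sum_cmult)
       (auto intro!: hd[OF homogeneous_polynomial_compose_matrix[OF hp[OF f]]]
         simp: partial_deriv_compose_matrix[OF hd[OF hp[OF f]]])
  have RR: "(\<Sum>i\<in>UNIV. R $ k $ i * R $ l $ i) = (if k = l then 1 else 0)" for k l
  proof -
    have "(R ** transpose R) $ k $ l = mat 1 $ k $ l" using R by (simp add: orthogonal_matrix_def)
    then show ?thesis by (simp add: matrix_matrix_mult_def transpose_def mat_def)
  qed
  have "laplacian (\<lambda>x. f (R *v x)) x
     = (\<Sum>i\<in>UNIV. \<Sum>k\<in>UNIV. \<Sum>l\<in>UNIV. R $ k $ i * R $ l $ i * partial_deriv l (partial_deriv k f) (R *v x))"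
    unfolding laplacian_def 1 2 by (simp add: sum_distrib_left mult.assoc)
  also have "\<dots> = (\<Sum>k\<in>UNIV. \<Sum>l\<in>UNIV. \<Sum>i\<in>UNIV. R $ k $ i * R $ l $ i * partial_deriv l (partial_deriv k f) (R *v x))"
    by (subst sum.swap, rule sum.cong[OF refl], subst sum.swap, simp)
  also have "\<dots> = (\<Sum>k\<in>UNIV. \<Sum>l\<in>UNIV. (if k = l then 1 else 0) * partial_deriv l (partial_deriv k f) (R *v x))"
    by (simp add: RR flip: sum_distrib_right)
  also have "\<dots> = laplacian f (R *v x)"
    by (simp add: laplacian_def if_distrib[of "\<lambda>x. x * _"] if_distribR cong: if_cong)
  finally show ?thesis .
qed

lemma homogeneous_harmonic_polynomial_map_compose_orthogonal:
  fixes R :: "real ^ 'n ^ 'n"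
  assumes "homogeneous_harmonic_polynomial_map m P" "orthogonal_matrix R"
  shows "homogeneous_harmonic_polynomial_map m (\<lambda>x. P (R *v x))"
proof -
  have "homogeneous_polynomial m (\<lambda>x. P x $ j)" "laplacian (\<lambda>x. P x $ j) x = 0" for j x
    using assms(1)
    by (auto simp: homogeneous_harmonic_polynomial_map_def homogeneous_harmonic_polynomial_def)
  then show ?thesis
    using homogeneous_polynomial_compose_matrix[of m "\<lambda>x. P x $ j" R for j]
      laplacian_compose_orthogonal[of m "\<lambda>x. P x $ j" R for j] assms(2)
    by (simp add: homogeneous_harmonic_polynomial_map_def homogeneous_harmonic_polynomial_def)
qed

lemma homogeneous_harmonic_polynomial_map_component:
  "homogeneous_harmonic_polynomial_map m P \<Longrightarrow> homogeneous_polynomial m (\<lambda>x. P x $ i)"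
  by (simp add: homogeneous_harmonic_polynomial_map_def homogeneous_harmonic_polynomial_def)

lemma homogeneous_harmonic_polynomial_map_scaleR:
  assumes "homogeneous_harmonic_polynomial_map m P"
  shows "P (s *\<^sub>R x) = s ^ m *\<^sub>R P x"
  using homogeneous_polynomial_scaleR[OF homogeneous_harmonic_polynomial_map_component[OF assms]] by (simp add: vec_eq_iff)

lemma homogeneous_harmonic_polynomial_map_continuous_on:
  assumes "homogeneous_harmonic_polynomial_map m P"
  shows "continuous_on S P"
  using continuous_on_vec_lambda[of S "\<lambda>i x. P x $ i"]
    homogeneous_polynomial_continuous_on[OF homogeneous_harmonic_polynomial_map_component[OF assms]] by simp

subsection \<open>Harmonic forms in three variables\<close>

text \<open>Summing over the whole square makes restriction to \<open>x $ 3 = 1\<close> an ordinary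
  double sum in two variables. For \<open>i + j > m\<close> the last exponent is truncated to 0, so
  homogeneity requires these coefficients to vanish.\<close>

definition ternary_form :: "nat \<Rightarrow> (nat \<Rightarrow> nat \<Rightarrow> real) \<Rightarrow> real ^ 3 \<Rightarrow> real"
  where "ternary_form m c x = (\<Sum>i\<le>m. \<Sum>j\<le>m. c i j * (x $ 1 ^ i * x $ 2 ^ j * x $ 3 ^ (m - i - j)))"

definition exponents :: "nat \<Rightarrow> nat \<Rightarrow> nat \<Rightarrow> 3 \<Rightarrow> nat"
  where "exponents m i j k = (if k = 1 then i else if k = 2 then j else m - i - j)"

lemma exponents_simps [simp]:
  "exponents m i j 1 = i" "exponents m i j 2 = j" "exponents m i j 3 = m - i - j"
  by (auto simp: exponents_def)

lemma exponents_multi_index: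
  "\<alpha> \<in> multi_indices m \<Longrightarrow> exponents m (\<alpha> 1) (\<alpha> 2) = \<alpha>"
  by (auto simp: multi_indices_def sum_3 fun_eq_iff forall_3)

lemma prod_3: "prod f (UNIV::3 set) = f 1 * f 2 * f 3"
  unfolding UNIV_3 by (simp add: ac_simps)

lemma ternary_form_monomials:
  "ternary_form m c = (\<lambda>x. \<Sum>s\<in>{..m} \<times> {..m}. c (fst s) (snd s) * (\<Prod>i\<in>UNIV. (x $ i) ^ exponents m (fst s) (snd s) i))"
  unfolding ternary_form_def prod_3 sum.cartesian_product case_prod_unfold exponents_simps ..

lemma homogeneous_polynomial_ternary_form:
  assumes "homogeneous_polynomial m f"
  obtains c where "\<And>i j. i + j > m \<Longrightarrow> c i j = 0" "f = ternary_form m c"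
proof -
  obtain d where d: "\<And>x. f x = (\<Sum>\<alpha>\<in>multi_indices m. d \<alpha> * (\<Prod>i\<in>UNIV. (x $ i) ^ \<alpha> i))"
    using assms unfolding homogeneous_polynomial_def by blast
  define c where "c i j = (if i + j \<le> m then d (exponents m i j) else 0)" for i j
  let ?T = "{s \<in> {..m} \<times> {..m}. fst s + snd s \<le> m}"
  have "f x = ternary_form m c x" for x
  proof -
    have "f x = (\<Sum>s\<in>?T. d (exponents m (fst s) (snd s)) * (\<Prod>i\<in>UNIV. (x $ i) ^ exponents m (fst s) (snd s) i))"
      unfolding d
      by (rule sum.reindex_bij_witness[of _ "\<lambda>s. exponents m (fst s) (snd s)" "\<lambda>\<alpha>. (\<alpha> 1, \<alpha> 2)"])
         (auto simp: exponents_multi_index, auto simp: multi_indices_def sum_3)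
    also have "\<dots> = (\<Sum>s\<in>?T. c (fst s) (snd s) * (\<Prod>i\<in>UNIV. (x $ i) ^ exponents m (fst s) (snd s) i))"
      by (intro sum.cong) (auto simp: c_def)
    also have "\<dots> = ternary_form m c x"
      unfolding ternary_form_monomials by (rule sum.mono_neutral_left) (auto simp: c_def)
    finally show ?thesis .
  qed
  then show thesis by (intro that[of c]) (auto simp: c_def)
qed

lemma distinct_indices_3: "(1::3) = 2 \<longleftrightarrow> False" "(1::3) = 3 \<longleftrightarrow> False" "(2::3) = 1 \<longleftrightarrow> False"
  "(2::3) = 3 \<longleftrightarrow> False" "(3::3) = 1 \<longleftrightarrow> False" "(3::3) = 2 \<longleftrightarrow> False" "((x::3) = x) = True"
  by simp_all

lemma laplacian_monomials:
  fixes e :: "'s \<Rightarrow> 'n::finite \<Rightarrow> nat"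
  assumes "finite S"
  shows "laplacian (\<lambda>x. \<Sum>s\<in>S. c s * (\<Prod>i\<in>UNIV. (x $ i) ^ e s i)) x
    = (\<Sum>k\<in>UNIV. \<Sum>s\<in>S. c s * real (e s k) * real (e s k - 1)
        * (\<Prod>i\<in>UNIV. (x $ i) ^ ((e s)(k := e s k - 2)) i))"
  unfolding laplacian_def partial_deriv_monomials[OF assms]
  by (simp add: numeral_2_eq_2)

text \<open>Below, truncated subtraction is harmless: the factors \<open>real i * real (i - 1)\<close> vanish for \<open>i \<le> 1\<close>.\<close>

lemma sum_shift_second_derivative:
  fixes c :: "nat \<Rightarrow> real"
  assumes "\<And>i. i > m \<Longrightarrow> c i = 0"
  shows "(\<Sum>i\<le>m. c i * real i * real (i - 1) * a ^ (i - 2))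
    = (\<Sum>i\<le>m. real (i + 2) * real (i + 1) * c (i + 2) * a ^ i)"
proof -
  let ?g = "\<lambda>i. c i * real i * real (i - 1) * a ^ (i - 2)"
  have "(\<Sum>i\<le>m. ?g i) = (\<Sum>i\<le>Suc (Suc m). ?g i)"
    using assms by simp
  also have "\<dots> = (\<Sum>i\<le>m. ?g (Suc (Suc i)))"
    by (subst sum.atMost_Suc_shift, subst sum.atMost_Suc_shift) simp
  also have "\<dots> = (\<Sum>i\<le>m. real (i + 2) * real (i + 1) * c (i + 2) * a ^ i)"
    by (intro sum.cong) auto
  finally show ?thesis .
qed

lemma polynomial_two_variables_eq_0:
  fixes d :: "nat \<Rightarrow> nat \<Rightarrow> real"
  assumes "\<And>a b. (\<Sum>i\<le>m. \<Sum>j\<le>n. d i j * a ^ i * b ^ j) = 0" "i \<le> m" "j \<le> n"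
  shows "d i j = 0"
proof -
  have "(\<Sum>i\<le>m. (\<Sum>j\<le>n. d i j * b ^ j) * a ^ i) = 0" for a b
    using assms(1)[of a b] by (simp add: sum_distrib_right mult.assoc mult.commute[of "a ^ _"])
  then have "(\<Sum>j\<le>n. d i j * b ^ j) = 0" for b
    using polyfun_eq_0[of "\<lambda>i. \<Sum>j\<le>n. d i j * b ^ j" m for b] assms(2) by blast
  then show ?thesis using polyfun_eq_0[of "d i" n] assms(3) by blast
qed

text \<open>The left side is the coefficient of \<open>x $ 1 ^ i * x $ 2 ^ j\<close> in the
  Laplacian restricted to the plane \<open>x $ 3 = 1\<close>, where different monomials stay
  different. The last product uses real subtraction; at \<open>i + j = m\<close> it vanishes just
  like its truncated counterpart.\<close>

lemma harmonic_ternary_form_recurrence: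
  assumes c: "\<And>i j. i + j > m \<Longrightarrow> c i j = 0"
    and harm: "\<And>x. laplacian (ternary_form m c) x = 0"
  shows "real (i + 2) * real (i + 1) * c (i + 2) j + real (j + 2) * real (j + 1) * c i (j + 2)
    + (real m - real i - real j) * (real m - real i - real j - 1) * c i j = 0"
proof (cases "i + j \<le> m")
  case False
  then show ?thesis by (simp add: c)
next
  case True
  define d where "d i j = real (i + 2) * real (i + 1) * c (i + 2) j + real (j + 2) * real (j + 1) * c i (j + 2)
    + real (m - i - j) * real (m - i - j - 1) * c i j" for i j
  have "(\<Sum>i\<le>m. \<Sum>j\<le>m. d i j * a ^ i * b ^ j) = 0" for a b
  proof -
    have "0 = laplacian (ternary_form m c) (vector [a, b, 1])" by (simp add: harm)
    also have "\<dots> = (\<Sum>k\<in>UNIV. \<Sum>i\<le>m. \<Sum>j\<le>m. c i j * real (exponents m i j k) *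
          real (exponents m i j k - 1) *
          (\<Prod>l\<in>UNIV. vector [a, b, 1] $ l ^ ((exponents m i j)(k := exponents m i j k - 2)) l))"
      unfolding ternary_form_monomials laplacian_monomials[OF finite_cartesian_product[OF finite_atMost finite_atMost]]
        sum.cartesian_product by (simp add: case_prod_unfold)
    also have "\<dots> = (\<Sum>i\<le>m. \<Sum>j\<le>m. c i j * real i * real (i - 1) * (a ^ (i - 2) * b ^ j))
        + (\<Sum>i\<le>m. \<Sum>j\<le>m. c i j * real j * real (j - 1) * (a ^ i * b ^ (j - 2)))
        + (\<Sum>i\<le>m. \<Sum>j\<le>m. real (m - i - j) * real (m - i - j - 1) * c i j * a ^ i * b ^ j)"
      unfolding sum_3 prod_3 fun_upd_apply
      by (simp only: exponents_simps vector_3 distinct_indices_3 if_True if_False power_one mult_1_right mult.commute[of "c _ _"] mult.assoc)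
    also have "(\<Sum>i\<le>m. \<Sum>j\<le>m. c i j * real i * real (i - 1) * (a ^ (i - 2) * b ^ j))
        = (\<Sum>j\<le>m. (\<Sum>i\<le>m. c i j * real i * real (i - 1) * a ^ (i - 2)) * b ^ j)"
      by (subst sum.swap) (simp add: sum_distrib_right mult.assoc)
    also have "\<dots> = (\<Sum>i\<le>m. \<Sum>j\<le>m. real (i + 2) * real (i + 1) * c (i + 2) j * a ^ i * b ^ j)"
      using c by (subst sum_shift_second_derivative) (simp, simp only: sum_distrib_right, rule sum.swap)
    also have "(\<Sum>i\<le>m. \<Sum>j\<le>m. c i j * real j * real (j - 1) * (a ^ i * b ^ (j - 2)))
        = (\<Sum>i\<le>m. (\<Sum>j\<le>m. c i j * real j * real (j - 1) * b ^ (j - 2)) * a ^ i)"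
      by (simp add: sum_distrib_right mult.assoc mult.commute[of "a ^ _"])
    also have "\<dots> = (\<Sum>i\<le>m. \<Sum>j\<le>m. real (j + 2) * real (j + 1) * c i (j + 2) * a ^ i * b ^ j)"
      using c by (subst sum_shift_second_derivative)
        (simp, simp add: sum_distrib_right mult.assoc mult.commute[of "a ^ _"])
    finally show ?thesis
      by (simp add: d_def distrib_right flip: sum.distrib)
  qed
  then have "d i j = 0"
    using polynomial_two_variables_eq_0[of d m m i j] True by auto
  moreover have "real (m - i - j) * real (m - i - j - 1)
      = (real m - real i - real j) * (real m - real i - real j - 1)"
    using True by (cases "m = i + j") (auto simp: of_nat_diff algebra_simps)
  ultimately show ?thesis by (simp add: d_def)
qed

lemma harmonic_map_coefficients:
  fixes P :: "real ^ 3 \<Rightarrow> real ^ 'n"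
  assumes P: "homogeneous_harmonic_polynomial_map m P"
  obtains c where "\<And>n i j. i + j > m \<Longrightarrow> c n i j = 0" "\<And>n. (\<lambda>x. P x $ n) = ternary_form m (c n)"
    "\<And>n i j. real (i + 2) * real (i + 1) * c n (i + 2) j + real (j + 2) * real (j + 1) * c n i (j + 2)
      + (real m - real i - real j) * (real m - real i - real j - 1) * c n i j = 0"
proof -
  have "\<forall>n. \<exists>c. (\<forall>i j. i + j > m \<longrightarrow> c i j = 0) \<and> (\<lambda>x. P x $ n) = ternary_form m c"
    using homogeneous_polynomial_ternary_form[OF homogeneous_harmonic_polynomial_map_component[OF P]] by metis
  then obtain c where c: "\<And>n i j. i + j > m \<Longrightarrow> c n i j = 0" "\<And>n. (\<lambda>x. P x $ n) = ternary_form m (c n)"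
    by metis
  have "laplacian (ternary_form m (c n)) x = 0" for n x
    using P by (simp add: homogeneous_harmonic_polynomial_map_def homogeneous_harmonic_polynomial_def
        flip: c(2)[of n])
  from that[OF c harmonic_ternary_form_recurrence[OF c(1) this]] show thesis .
qed

subsection \<open>A zero of the Jacobian determinant\<close>

definition jacobian_matrix :: "(real ^ 'n \<Rightarrow> real ^ 'n) \<Rightarrow> real ^ 'n \<Rightarrow> real ^ 'n ^ 'n"
  where "jacobian_matrix P x = (\<chi> i j. partial_deriv j (\<lambda>x. P x $ i) x)"

lemma jacobian_matrix_compose:
  fixes P :: "real ^ 'n \<Rightarrow> real ^ 'n"
  assumes "homogeneous_harmonic_polynomial_map m P"
  shows "jacobian_matrix (\<lambda>x. P (R *v x)) x = jacobian_matrix P (R *v x) ** R"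
  using partial_deriv_compose_matrix[OF homogeneous_polynomial_differentiable[OF homogeneous_harmonic_polynomial_map_component[OF assms]]]
  by (simp add: jacobian_matrix_def matrix_matrix_mult_def vec_eq_iff mult.commute)

lemma det_jacobian_matrix_scaleR:
  fixes P :: "real ^ 3 \<Rightarrow> real ^ 3"
  assumes "homogeneous_harmonic_polynomial_map m P"
  shows "det (jacobian_matrix P (s *\<^sub>R x)) = (s ^ (m - 1)) ^ 3 * det (jacobian_matrix P x)"
proof -
  have "partial_deriv j (\<lambda>x. P x $ i) (s *\<^sub>R x) = s ^ (m - 1) * partial_deriv j (\<lambda>x. P x $ i) x" for i j
    by (rule homogeneous_polynomial_scaleR[OF homogeneous_polynomial_partial_deriv[OF homogeneous_harmonic_polynomial_map_component[OF assms]]])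
  then show ?thesis
    by (simp add: det_3 jacobian_matrix_def algebra_simps power3_eq_cube)
qed

lemma continuous_on_det_jacobian_matrix:
  fixes P :: "real ^ 3 \<Rightarrow> real ^ 3"
  assumes "homogeneous_harmonic_polynomial_map m P"
  shows "continuous_on S (\<lambda>x. det (jacobian_matrix P x))"
proof -
  have "continuous_on S (\<lambda>x. jacobian_matrix P x $ i $ j)" for i j
    unfolding jacobian_matrix_def
    using homogeneous_polynomial_continuous_on[OF homogeneous_polynomial_partial_deriv[OF homogeneous_harmonic_polynomial_map_component[OF assms]]]
    by simp
  then show ?thesis unfolding det_3
    by (intro continuous_on_add continuous_on_diff continuous_on_mult)
qed

section \<open>Scalar triple products of real vectors and of polynomial columns\<close>

definition triple :: "real ^ 3 \<Rightarrow> real ^ 3 \<Rightarrow> real ^ 3 \<Rightarrow> real"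
  where "triple u v w = u \<bullet> cross3 v w"

lemma triple_linear [simp]:
  "triple (u + u') v w = triple u v w + triple u' v w"
  "triple u (v + v') w = triple u v w + triple u v' w"
  "triple u v (w + w') = triple u v w + triple u v w'"
  "triple (a *\<^sub>R u) v w = a * triple u v w"
  "triple u (a *\<^sub>R v) w = a * triple u v w"
  "triple u v (a *\<^sub>R w) = a * triple u v w"
  by (simp_all add: triple_def inner_add_left inner_add_right cross_add_left cross_add_right
      cross_mult_left cross_mult_right)

lemma triple_same [simp]: "triple u u w = 0" "triple u v u = 0" "triple u v v = 0"
  by (simp_all add: triple_def dot_cross_self)

lemma triple_swap: "triple v u w = - triple u v w" "triple u w v = - triple u v w"
  by (simp_all add: triple_def cross3_simps)

lemma triple_swap_13: "triple w v u = - triple u v w"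
  by (simp add: triple_def cross3_simps)

text \<open>Keeping the determinant on the left avoids division, so linearly dependent vectors are
  covered too. With a nonzero determinant it gives the coordinates of \<open>x\<close> in the
  basis.\<close>

lemma cramer_triple: "triple u v w *\<^sub>R x = triple x v w *\<^sub>R u + triple u x w *\<^sub>R v + triple u v x *\<^sub>R w"
  by (simp add: triple_def cross3_simps forall_3)

lemma det_columns: "det (\<chi> i j. M i j) = triple (\<chi> i. M i 1) (\<chi> i. M i 2) (\<chi> i. M i 3)"
  by (simp add: triple_def cross3_simps)

text \<open>\<open>triple\<close> is confined to real vectors. The same expression over the
  polynomial ring gives access to the Taylor coefficients of a determinant whose columns depend
  polynomially on a parameter.\<close>

definition triple_poly :: "(3 \<Rightarrow> real poly) \<Rightarrow> (3 \<Rightarrow> real poly) \<Rightarrow> (3 \<Rightarrow> real poly) \<Rightarrow> real poly"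
  where "triple_poly u v w = u 1 * (v 2 * w 3 - v 3 * w 2) + u 2 * (v 3 * w 1 - v 1 * w 3)
    + u 3 * (v 1 * w 2 - v 2 * w 1)"

lemma poly_triple_poly:
  "poly (triple_poly u v w) t = triple (\<chi> i. poly (u i) t) (\<chi> i. poly (v i) t) (\<chi> i. poly (w i) t)"
  by (simp add: triple_poly_def triple_def cross3_simps)

lemma coeff_mult_012:
  fixes p q :: "real poly"
  shows "coeff (p * q) 0 = coeff p 0 * coeff q 0"
    "coeff (p * q) 1 = coeff p 0 * coeff q 1 + coeff p 1 * coeff q 0"
    "coeff (p * q) 2 = coeff p 0 * coeff q 2 + coeff p 1 * coeff q 1 + coeff p 2 * coeff q 0"
  by (simp_all add: coeff_mult numeral_2_eq_2)

lemma coeff_triple_poly: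
  fixes u v w :: "3 \<Rightarrow> real poly"
  defines "U \<equiv> \<lambda>k. \<chi> i. coeff (u i) k" and "V \<equiv> \<lambda>k. \<chi> i. coeff (v i) k" and "W \<equiv> \<lambda>k. \<chi> i. coeff (w i) k"
  shows "coeff (triple_poly u v w) 0 = triple (U 0) (V 0) (W 0)"
    "coeff (triple_poly u v w) 1 = triple (U 1) (V 0) (W 0) + triple (U 0) (V 1) (W 0) + triple (U 0) (V 0) (W 1)"
    "coeff (triple_poly u v w) 2 = triple (U 2) (V 0) (W 0) + triple (U 0) (V 2) (W 0) + triple (U 0) (V 0) (W 2)
      + triple (U 1) (V 1) (W 0) + triple (U 1) (V 0) (W 1) + triple (U 0) (V 1) (W 1)"
  unfolding triple_poly_def coeff_add coeff_diff coeff_mult_012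
  by (simp_all add: U_def V_def W_def triple_def cross3_simps)

text \<open>The quotient of \<open>q\<close> by \<open>t\<close> has the sign of \<open>t\<close>,
  so its one-sided limits at 0 force the linear coefficient to be both nonnegative and nonpositive.
  Dividing once more and letting t tend to 0 from the right bounds the quadratic
  coefficient.\<close>

lemma nonneg_poly_double_root:
  fixes q :: "real poly"
  assumes "\<And>t. poly q t \<ge> 0" "coeff q 0 = 0"
  shows "coeff q 1 = 0" "coeff q 2 \<ge> 0"
proof -
  obtain a b r where q: "q = pCons 0 (pCons a (pCons b r))"
    using assms(2) by (metis coeff_pCons_0 pCons_cases)
  have pos: "poly (pCons a (pCons b r)) t \<ge> 0" if "t > 0" for t
    using assms(1)[of t] that by (simp add: q zero_le_mult_iff)
  have neg: "poly (pCons a (pCons b r)) t \<le> 0" if "t < 0" for t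
    using assms(1)[of t] that by (simp add: q zero_le_mult_iff)
  have lim: "(poly p \<longlongrightarrow> poly p 0) (at_right 0)" "(poly p \<longlongrightarrow> poly p 0) (at_left 0)" 
    for p :: "real poly"
    using poly_isCont[of 0 p] by (auto simp: isCont_def filterlim_at_split)
  have "\<forall>\<^sub>F t in at_right 0. 0 \<le> poly (pCons a (pCons b r)) t"
    using eventually_at_right_less[of "0::real"] by (rule eventually_mono) (rule pos)
  from tendsto_lowerbound[OF lim(1) this] have "a \<ge> 0" by simp
  moreover have "\<forall>\<^sub>F t in at_left 0. poly (pCons a (pCons b r)) t \<le> 0"
    by (rule eventually_mono[OF _ neg]) (auto simp: eventually_at_filter intro: always_eventually)
  from tendsto_upperbound[OF lim(2) this] have "a \<le> 0" by simp
  ultimately have a: "a = 0" by simp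
  have "poly (pCons b r) t \<ge> 0" if "t > 0" for t
    using pos[OF that] that by (simp add: a zero_le_mult_iff)
  then have "\<forall>\<^sub>F t in at_right 0. 0 \<le> poly (pCons b r) t"
    by (intro eventually_mono[OF eventually_at_right_less[of "0::real"]])
  from tendsto_lowerbound[OF lim(1) this] have "b \<ge> 0" by simp
  with a show "coeff q 1 = 0" "coeff q 2 \<ge> 0" by (simp_all add: q numeral_2_eq_2)
qed

text \<open>Squaring makes the growth condition insensitive to the sign of the Jacobian determinant and keeps
  the power of the norm a polynomial.\<close>

lemma poly_square_growth:
  fixes q :: "real poly"
  assumes "\<And>t. (poly q t)\<^sup>2 \<ge> (coeff q 0)\<^sup>2 * (1 + d * t\<^sup>2)" "coeff q 0 \<noteq> 0"
  shows "coeff q 1 = 0" "2 * coeff q 2 * coeff q 0 \<ge> d * (coeff q 0)\<^sup>2"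
proof -
  let ?r = "q * q - [:(coeff q 0)\<^sup>2, 0, d * (coeff q 0)\<^sup>2:]"
  have "poly ?r t \<ge> 0" for t
    using assms(1)[of t] by (simp add: power2_eq_square algebra_simps)
  moreover have "coeff ?r 0 = 0" by (simp add: coeff_mult_012 power2_eq_square)
  ultimately have *: "coeff ?r 1 = 0" "coeff ?r 2 \<ge> 0" by (rule nonneg_poly_double_root)+
  from *(1) show 1: "coeff q 1 = 0"
    using assms(2) unfolding coeff_diff coeff_mult_012 by simp
  from *(2) show "2 * coeff q 2 * coeff q 0 \<ge> d * (coeff q 0)\<^sup>2"
    using 1 unfolding coeff_diff coeff_mult_012 by (simp add: numeral_2_eq_2 mult_ac)
qed

section \<open>The Jacobian determinant on tangent lines at the pole\<close>

lemma partial_deriv_ternary_form: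
  "partial_deriv k (ternary_form m c) x = (\<Sum>i\<le>m. \<Sum>j\<le>m. c i j * real (exponents m i j k)
     * (\<Prod>l\<in>UNIV. x $ l ^ ((exponents m i j)(k := exponents m i j k - 1)) l))"
  unfolding ternary_form_monomials
  by (simp add: partial_deriv_monomials sum.cartesian_product case_prod_unfold)

definition truncated_poly :: "nat \<Rightarrow> (nat \<Rightarrow> real) \<Rightarrow> real poly"
  where "truncated_poly m d = (\<Sum>i\<le>m. monom (d i) i)"

lemma poly_truncated_poly: "poly (truncated_poly m d) t = (\<Sum>i\<le>m. d i * t ^ i)"
  by (simp add: truncated_poly_def poly_sum poly_monom)

lemma coeff_truncated_poly:
  "(\<And>i. i > m \<Longrightarrow> d i = 0) \<Longrightarrow> coeff (truncated_poly m d) n = d n"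
  by (cases "n \<le> m") (auto simp: truncated_poly_def coeff_sum sum.delta)

lemma sum_shift_derivative:
  fixes c :: "nat \<Rightarrow> real"
  assumes "c (Suc m) = 0"
  shows "(\<Sum>i\<le>m. c i * real i * a ^ (i - 1)) = (\<Sum>i\<le>m. real (i + 1) * c (i + 1) * a ^ i)"
proof -
  have "(\<Sum>i\<le>m. c i * real i * a ^ (i - 1)) = (\<Sum>i\<le>Suc m. c i * real i * a ^ (i - 1))"
    using assms by simp
  also have "\<dots> = (\<Sum>i\<le>m. real (i + 1) * c (i + 1) * a ^ i)"
    by (subst sum.atMost_Suc_shift) (simp add: mult_ac)
  finally show ?thesis .
qed

text \<open>On the tangent line in the first direction the second coordinate is 0, so only terms
  with \<open>j = 0\<close>, or with \<open>j = 1\<close> after differentiating in that direction,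
  survive. The results are the entries of the Jacobian matrix as polynomials in
  \<open>t\<close>.\<close>

lemma partial_deriv_ternary_form_line_1:
  assumes c: "\<And>i j. i + j > m \<Longrightarrow> c i j = 0" and m: "m > 0"
  shows "partial_deriv 1 (ternary_form m c) (vector [t, 0, 1])
      = poly (truncated_poly m (\<lambda>i. real (i + 1) * c (i + 1) 0)) t"
    "partial_deriv 2 (ternary_form m c) (vector [t, 0, 1])
      = poly (truncated_poly m (\<lambda>i. c i 1)) t"
    "partial_deriv 3 (ternary_form m c) (vector [t, 0, 1])
      = poly (truncated_poly m (\<lambda>i. (real m - real i) * c i 0)) t"
proof -
  note simps = partial_deriv_ternary_form prod_3 fun_upd_apply exponents_simps vector_3
    distinct_indices_3 if_True if_False power_one mult_1_right poly_truncated_poly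
  have delta: "(\<Sum>j\<le>m. f j * (a * 0 ^ j)) = f 0 * a" for f :: "nat \<Rightarrow> real" and a
    by (subst sum.remove[of _ 0]) (auto simp: power_0_left)
  \<comment> \<open>The factor \<open>real j\<close> removes \<open>j = 0\<close>, where truncation
    gives \<open>0 ^ 0 = 1\<close>; the power of 0 removes \<open>j > 1\<close>. That
    \<open>m > 0\<close> puts the index 1 into the range.\<close>
  have delta1: "(\<Sum>j\<le>m. f j * real j * (a * 0 ^ (j - 1))) = f 1 * a" for f :: "nat \<Rightarrow> real" and a
    using m by (subst sum.remove[of _ 1]) (auto simp: power_0_left intro!: sum.neutral split: if_splits)
  show "partial_deriv 1 (ternary_form m c) (vector [t, 0, 1])
      = poly (truncated_poly m (\<lambda>i. real (i + 1) * c (i + 1) 0)) t"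
    unfolding simps delta using sum_shift_derivative[of "\<lambda>i. c i 0" m t] c by simp
  show "partial_deriv 2 (ternary_form m c) (vector [t, 0, 1])
      = poly (truncated_poly m (\<lambda>i. c i 1)) t"
    unfolding simps delta1 ..
  show "partial_deriv 3 (ternary_form m c) (vector [t, 0, 1])
      = poly (truncated_poly m (\<lambda>i. (real m - real i) * c i 0)) t"
    unfolding simps delta by (auto simp: of_nat_diff intro!: sum.cong)
qed

lemma partial_deriv_ternary_form_line_2:
  assumes c: "\<And>i j. i + j > m \<Longrightarrow> c i j = 0" and m: "m > 0"
  shows "partial_deriv 1 (ternary_form m c) (vector [0, t, 1])
      = poly (truncated_poly m (\<lambda>j. c 1 j)) t"
    "partial_deriv 2 (ternary_form m c) (vector [0, t, 1])
      = poly (truncated_poly m (\<lambda>j. real (j + 1) * c 0 (j + 1))) t"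
    "partial_deriv 3 (ternary_form m c) (vector [0, t, 1])
      = poly (truncated_poly m (\<lambda>j. (real m - real j) * c 0 j)) t"
proof -
  note simps = partial_deriv_ternary_form prod_3 fun_upd_apply exponents_simps vector_3
    distinct_indices_3 if_True if_False power_one mult_1_right poly_truncated_poly
  have delta: "(\<Sum>i\<le>m. \<Sum>j\<le>m. f i j * (0 ^ i * g j)) = (\<Sum>j\<le>m. f 0 j * g j)"
    for f :: "nat \<Rightarrow> nat \<Rightarrow> real" and g
    by (subst sum.remove[of _ 0]) (auto simp: power_0_left)
  have delta1: "(\<Sum>i\<le>m. \<Sum>j\<le>m. f i j * real i * (0 ^ (i - 1) * g j)) = (\<Sum>j\<le>m. f 1 j * g j)"
    for f :: "nat \<Rightarrow> nat \<Rightarrow> real" and g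
    using m by (subst sum.remove[of _ 1]) (auto simp: power_0_left intro!: sum.neutral split: if_splits)
  show "partial_deriv 1 (ternary_form m c) (vector [0, t, 1])
      = poly (truncated_poly m (\<lambda>j. c 1 j)) t"
    unfolding simps delta1 ..
  show "partial_deriv 2 (ternary_form m c) (vector [0, t, 1])
      = poly (truncated_poly m (\<lambda>j. real (j + 1) * c 0 (j + 1))) t"
    unfolding simps delta using sum_shift_derivative[of "\<lambda>j. c 0 j" m t] c by simp
  show "partial_deriv 3 (ternary_form m c) (vector [0, t, 1])
      = poly (truncated_poly m (\<lambda>j. (real m - real j) * c 0 j)) t"
    unfolding simps delta by (auto simp: of_nat_diff intro!: sum.cong)
qed

text \<open>Scaling \<open>x\<close> to the unit sphere costs the factor
  \<open>norm x ^ (3 * (m - 1))\<close> by homogeneity. Its square is a power of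
  \<open>1 + t\<^sup>2\<close>, which Bernoulli's inequality bounds below by a quadratic
  polynomial.\<close>

lemma det_jacobian_matrix_growth:
  fixes P :: "real ^ 3 \<Rightarrow> real ^ 3"
  assumes P: "homogeneous_harmonic_polynomial_map m P"
    and min: "\<And>x. norm x = 1 \<Longrightarrow> \<bar>det (jacobian_matrix P x)\<bar> \<ge> J"
    and "J \<ge> 0" "(norm x)\<^sup>2 = 1 + t\<^sup>2"
  shows "(det (jacobian_matrix P x))\<^sup>2 \<ge> J\<^sup>2 * (1 + real (3 * (m - 1)) * t\<^sup>2)"
proof -
  let ?s = "norm x"
  have s: "?s \<noteq> 0"
  proof
    assume "norm x = 0"
    then show False using assms(4) by (simp add: add_nonneg_eq_0_iff)
  qed
  have "J \<le> \<bar>det (jacobian_matrix P ((1 / ?s) *\<^sub>R x))\<bar>" using s by (intro min) simp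
  then have "J\<^sup>2 \<le> (det (jacobian_matrix P ((1 / ?s) *\<^sub>R x)))\<^sup>2"
    using \<open>J \<ge> 0\<close> by (metis abs_le_square_iff abs_of_nonneg)
  moreover have "(det (jacobian_matrix P x))\<^sup>2
      = (?s ^ (m - 1)) ^ 6 * (det (jacobian_matrix P ((1 / ?s) *\<^sub>R x)))\<^sup>2"
    using det_jacobian_matrix_scaleR[OF P, of ?s "(1 / ?s) *\<^sub>R x"] s
    by (simp add: power_mult_distrib mult.commute flip: power_mult)
  moreover have "(?s ^ (m - 1)) ^ 6 = (1 + t\<^sup>2) ^ (3 * (m - 1))"
    unfolding assms(4)[symmetric] by (simp add: mult_ac flip: power_mult)
  moreover have "(1 + t\<^sup>2) ^ (3 * (m - 1)) \<ge> 1 + real (3 * (m - 1)) * t\<^sup>2"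
    by (rule Bernoulli_inequality) (use zero_le_power2[of t] in linarith)
  ultimately show ?thesis
    by (metis mult.commute mult_mono zero_le_power2 zero_le_power zero_le_even_power' add_nonneg_nonneg zero_le_one)
qed

text \<open>
  With \<open>C i j\<close> the vector coefficient of \<open>x\<^sup>i y\<^sup>j z\<^bsup>m-i-j\<^esup>\<close>, the expansion of the Jacobian determinant
  at the pole to second order involves \<open>C i j\<close> for \<open>i + j \<le> 3\<close> only. Writing \<open>C 2 0\<close> and
  \<open>C 1 1\<close> in the basis \<open>C 1 0\<close>, \<open>C 0 1\<close>, \<open>C 0 0\<close>, the first-order terms vanish precisely when
  the coordinates \<open>(a, b)\<close> and \<open>(a', b')\<close> satisfy the Cauchy-Riemann-like relations \<open>a' = 2 b\<close>,
  \<open>b' = - 2 a\<close>; this gives the quadratic part of the second-order term a sign.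
\<close>

lemma det_jacobian_pole_eq_0:
  fixes P :: "real ^ 3 \<Rightarrow> real ^ 3"
  assumes m: "m > 1" and P: "homogeneous_harmonic_polynomial_map m P"
    and min: "\<And>x. norm x = 1 \<Longrightarrow> \<bar>det (jacobian_matrix P x)\<bar> \<ge> \<bar>det (jacobian_matrix P (vector [0, 0, 1]))\<bar>"
  shows "det (jacobian_matrix P (vector [0, 0, 1])) = 0"
proof (rule ccontr)
  let ?J = "\<lambda>x. det (jacobian_matrix P x)"
  assume J0: "?J (vector [0, 0, 1]) \<noteq> 0"
  obtain c where c0: "\<And>n i j. i + j > m \<Longrightarrow> c n i j = 0" and Pc: "\<And>n. (\<lambda>x. P x $ n) = ternary_form m (c n)"
    and rec: "\<And>n i j. real (i + 2) * real (i + 1) * c n (i + 2) j + real (j + 2) * real (j + 1) * c n i (j + 2)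
      + (real m - real i - real j) * (real m - real i - real j - 1) * c n i j = 0"
    using harmonic_map_coefficients[OF P] by blast
  define C :: "nat \<Rightarrow> nat \<Rightarrow> real ^ 3" where "C i j = (\<chi> n. c n i j)" for i j
  \<comment> \<open>The recurrence at (0,0), (1,0) and (0,1) eliminates the coefficients
    \<open>C 0 2\<close>, \<open>C 1 2\<close> and \<open>C 0 3\<close>. This is the only place
    where harmonicity enters the computation.\<close>
  have C02: "C 0 2 = (-1) *\<^sub>R C 2 0 + (- (real m * (real m - 1) / 2)) *\<^sub>R C 0 0"
    using rec[of 0 _ 0] by (simp add: C_def vec_eq_iff field_simps numeral_2_eq_2)
  have C12: "C 1 2 = (-3) *\<^sub>R C 3 0 + (- ((real m - 1) * (real m - 2) / 2)) *\<^sub>R C 1 0"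
    using rec[of 1 _ 0] by (simp add: C_def vec_eq_iff field_simps numeral_2_eq_2 numeral_3_eq_3)
  have C03: "C 0 3 = (- 1 / 3) *\<^sub>R C 2 1 + (- ((real m - 1) * (real m - 2) / 6)) *\<^sub>R C 0 1"
    using rec[of 0 _ 1] by (simp add: C_def vec_eq_iff field_simps numeral_2_eq_2 numeral_3_eq_3)
  \<comment> \<open>\<open>q\<close> and \<open>q'\<close> are the Jacobian determinant on two
    perpendicular tangent lines through the pole; their quadratic coefficients add up to half the
    sum of the two tangential second derivatives.\<close>
  define q where "q = triple_poly (\<lambda>n. truncated_poly m (\<lambda>i. real (i + 1) * c n (i + 1) 0))
    (\<lambda>n. truncated_poly m (\<lambda>i. c n i 1)) (\<lambda>n. truncated_poly m (\<lambda>i. (real m - real i) * c n i 0))"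
  define q' where "q' = triple_poly (\<lambda>n. truncated_poly m (\<lambda>j. c n 1 j))
    (\<lambda>n. truncated_poly m (\<lambda>j. real (j + 1) * c n 0 (j + 1))) (\<lambda>n. truncated_poly m (\<lambda>j. (real m - real j) * c n 0 j))"
  have q: "?J (vector [t, 0, 1]) = poly q t" for t
    using m by (simp add: jacobian_matrix_def det_columns Pc q_def poly_triple_poly
        partial_deriv_ternary_form_line_1[OF c0])
  have q': "?J (vector [0, t, 1]) = poly q' t" for t
    using m by (simp add: jacobian_matrix_def det_columns Pc q'_def poly_triple_poly
        partial_deriv_ternary_form_line_2[OF c0])
  define D where "D = triple (C 1 0) (C 0 1) (C 0 0)"
  have arith: "(0::nat) + 1 = 1" "(1::nat) + 1 = 2" "(2::nat) + 1 = 3" by simp_all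
  have coq: "coeff q 0 = real m * D"
    "coeff q 1 = 2 * real m * triple (C 2 0) (C 0 1) (C 0 0) + real m * triple (C 1 0) (C 1 1) (C 0 0)"
    "coeff q 2 = real m * (3 * triple (C 3 0) (C 0 1) (C 0 0) + triple (C 1 0) (C 2 1) (C 0 0)
       - triple (C 1 0) (C 0 1) (C 2 0) + 2 * triple (C 2 0) (C 1 1) (C 0 0))"
  proof -
    have "(\<chi> n. coeff (truncated_poly m (\<lambda>i. real (i + 1) * c n (i + 1) 0)) k) = real (k + 1) *\<^sub>R C (k + 1) 0"
      "(\<chi> n. coeff (truncated_poly m (\<lambda>i. c n i 1)) k) = C k 1"
      "(\<chi> n. coeff (truncated_poly m (\<lambda>i. (real m - real i) * c n i 0)) k) = (real m - real k) *\<^sub>R C k 0" for k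
      by (simp_all add: coeff_truncated_poly c0 C_def vec_eq_iff)
    note * = coeff_triple_poly[of "\<lambda>n. truncated_poly m (\<lambda>i. real (i + 1) * c n (i + 1) 0)"
        "\<lambda>n. truncated_poly m (\<lambda>i. c n i 1)" "\<lambda>n. truncated_poly m (\<lambda>i. (real m - real i) * c n i 0)",
        folded q_def, unfolded this]
    \<comment> \<open>After this exchange the triple product of \<open>C 1 0\<close>,
      \<open>C 0 1\<close>, \<open>C 2 0\<close> has total factor
      \<open>(m - 2) - 2 * (m - 1) = - m\<close>, so \<open>real m\<close> can be taken out of the
      whole coefficient.\<close>
    have sw: "triple (C 2 0) (C 0 1) (C 1 0) = - triple (C 1 0) (C 0 1) (C 2 0)"
      by (rule triple_swap_13)
    show "coeff q 0 = real m * D"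
      unfolding * by (simp add: D_def)
    show "coeff q 1 = 2 * real m * triple (C 2 0) (C 0 1) (C 0 0) + real m * triple (C 1 0) (C 1 1) (C 0 0)"
      unfolding * by (simp add: numeral_2_eq_2)
    show "coeff q 2 = real m * (3 * triple (C 3 0) (C 0 1) (C 0 0) + triple (C 1 0) (C 2 1) (C 0 0)
       - triple (C 1 0) (C 0 1) (C 2 0) + 2 * triple (C 2 0) (C 1 1) (C 0 0))"
      unfolding * arith triple_linear triple_same sw by (simp add: algebra_simps)
  qed
  have coq': "coeff q' 0 = real m * D"
    "coeff q' 1 = real m * triple (C 1 1) (C 0 1) (C 0 0) + 2 * real m * triple (C 1 0) (C 0 2) (C 0 0)"
    "coeff q' 2 = real m * (triple (C 1 2) (C 0 1) (C 0 0) + 3 * triple (C 1 0) (C 0 3) (C 0 0)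
       - triple (C 1 0) (C 0 1) (C 0 2) + 2 * triple (C 1 1) (C 0 2) (C 0 0))"
  proof -
    have "(\<chi> n. coeff (truncated_poly m (\<lambda>j. c n 1 j)) k) = C 1 k"
      "(\<chi> n. coeff (truncated_poly m (\<lambda>j. real (j + 1) * c n 0 (j + 1))) k) = real (k + 1) *\<^sub>R C 0 (k + 1)"
      "(\<chi> n. coeff (truncated_poly m (\<lambda>j. (real m - real j) * c n 0 j)) k) = (real m - real k) *\<^sub>R C 0 k" for k
      by (simp_all add: coeff_truncated_poly c0 C_def vec_eq_iff)
    note * = coeff_triple_poly[of "\<lambda>n. truncated_poly m (\<lambda>j. c n 1 j)"
        "\<lambda>n. truncated_poly m (\<lambda>j. real (j + 1) * c n 0 (j + 1))" "\<lambda>n. truncated_poly m (\<lambda>j. (real m - real j) * c n 0 j)",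
        folded q'_def, unfolded this]
    have sw: "triple (C 1 0) (C 0 2) (C 0 1) = - triple (C 1 0) (C 0 1) (C 0 2)"
      by (rule triple_swap(2))
    show "coeff q' 0 = real m * D"
      unfolding * by (simp add: D_def)
    show "coeff q' 1 = real m * triple (C 1 1) (C 0 1) (C 0 0) + 2 * real m * triple (C 1 0) (C 0 2) (C 0 0)"
      unfolding * by (simp add: numeral_2_eq_2)
    show "coeff q' 2 = real m * (triple (C 1 2) (C 0 1) (C 0 0) + 3 * triple (C 1 0) (C 0 3) (C 0 0)
       - triple (C 1 0) (C 0 1) (C 0 2) + 2 * triple (C 1 1) (C 0 2) (C 0 0))"
      unfolding * arith triple_linear triple_same sw by (simp add: algebra_simps)
  qed
  have J: "?J (vector [0, 0, 1]) = real m * D"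
    using q[of 0] coq(1) by (simp add: poly_0_coeff_0)
  then have D: "D \<noteq> 0" using J0 by simp
  let ?d = "real (3 * (m - 1))"
  have "(norm (vector [t, 0, 1] :: real ^ 3))\<^sup>2 = 1 + t\<^sup>2" "(norm (vector [0, t, 1] :: real ^ 3))\<^sup>2 = 1 + t\<^sup>2" for t
    by (simp_all add: norm_vec_def L2_set_def sum_3 vector_3)
  note growth = this[THEN det_jacobian_matrix_growth[OF P min abs_ge_zero, rotated]]
  have g: "(poly q t)\<^sup>2 \<ge> (coeff q 0)\<^sup>2 * (1 + ?d * t\<^sup>2)" for t
    using growth(1)[of t] unfolding J power2_abs unfolding q coq .
  have g': "(poly q' t)\<^sup>2 \<ge> (coeff q' 0)\<^sup>2 * (1 + ?d * t\<^sup>2)" for t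
    using growth(2)[of t] unfolding J power2_abs unfolding q' coq' .
  have nz: "coeff q 0 \<noteq> 0" "coeff q' 0 \<noteq> 0" using J0 by (auto simp: coq coq' J)
  note r = poly_square_growth[OF g nz(1)] poly_square_growth[OF g' nz(2)]
  \<comment> \<open>By Cramer's rule these quotients are coordinates of \<open>C 2 0\<close>
    (\<open>a\<close>, \<open>b\<close>, \<open>e\<close>) and of \<open>C 1 1\<close>
    (\<open>a'\<close>, \<open>b'\<close>) in the basis \<open>C 1 0\<close>, \<open>C 0 1\<close>,
    \<open>C 0 0\<close>.\<close>
  define a where "a = triple (C 2 0) (C 0 1) (C 0 0) / D"
  define b where "b = triple (C 1 0) (C 2 0) (C 0 0) / D"
  define e where "e = triple (C 1 0) (C 0 1) (C 2 0) / D"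
  define a' where "a' = triple (C 1 1) (C 0 1) (C 0 0) / D"
  define b' where "b' = triple (C 1 0) (C 1 1) (C 0 0) / D"
  have X: "triple (C 2 0) (C 0 1) (C 0 0) = a * D" "triple (C 1 0) (C 2 0) (C 0 0) = b * D"
    "triple (C 1 0) (C 0 1) (C 2 0) = e * D"
    and Y: "triple (C 1 1) (C 0 1) (C 0 0) = a' * D" "triple (C 1 0) (C 1 1) (C 0 0) = b' * D"
    using D by (simp_all add: a_def b_def e_def a'_def b'_def)
  \<comment> \<open>Expanding \<open>C 2 0\<close> in the basis leaves a two by two determinant of
    coordinates, since its component along \<open>C 0 0\<close> repeats the last column.\<close>
  have XY: "triple (C 2 0) (C 1 1) (C 0 0) = (a * b' - b * a') * D"
  proof -
    have "D * triple (C 2 0) (C 1 1) (C 0 0) = triple (D *\<^sub>R C 2 0) (C 1 1) (C 0 0)" by simp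
    also have "\<dots> = (a * D) * (b' * D) + (b * D) * (triple (C 0 1) (C 1 1) (C 0 0))"
      unfolding D_def cramer_triple[of _ _ _ "C 2 0"] unfolding D_def[symmetric] X triple_linear triple_same Y by simp
    also have "triple (C 0 1) (C 1 1) (C 0 0) = - (a' * D)"
      using triple_swap(1)[of "C 0 1" "C 1 1"] Y by simp
    finally have "D * triple (C 2 0) (C 1 1) (C 0 0) = D * ((a * b' - b * a') * D)"
      by (simp add: algebra_simps)
    then show ?thesis using D by simp
  qed
  have YX: "triple (C 1 1) (C 2 0) (C 0 0) = - ((a * b' - b * a') * D)"
    using triple_swap(1)[of "C 1 1" "C 2 0"] XY by simp
  \<comment> \<open>The growth bounds force both linear coefficients to vanish: the pole is a
    critical point on either line.\<close>
  have "real m * D * (2 * a + b') = 0" using r(1) unfolding coq X Y by (simp add: algebra_simps)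
  then have b': "b' = - 2 * a" using D m by simp
  have "real m * D * (a' - 2 * b) = 0"
    using r(3) unfolding coq' X Y C02 triple_linear triple_same by (simp add: algebra_simps)
  then have a': "a' = 2 * b" using D m by simp
  \<comment> \<open>In the sum the terms with \<open>C 3 0\<close>, \<open>C 2 1\<close> and
    \<open>e\<close> cancel between the two lines. What is left are the multiples of
    \<open>D\<close> from the recurrence, \<open>(m - 1) * (4 - m) / 2\<close> in all, and
    \<open>4 * (a * b' - b * a')\<close>, which equals \<open>- 8 * (a * a + b * b)\<close>.\<close>
  let ?K = "(real m - 1) * (4 - real m) / 2 - 8 * (a * a) - 8 * (b * b)"
  have "coeff q 2 + coeff q' 2 = real m * D * ?K"
    unfolding coq coq' C02 C12 C03 triple_linear triple_same X Y XY YX a' b' D_def[symmetric]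
    by (simp add: field_simps)
  moreover have "2 * (coeff q 2 + coeff q' 2) * (real m * D) \<ge> 2 * ?d * (real m * D)\<^sup>2"
    using r(2,4) unfolding coq(1) coq'(1) by (simp add: algebra_simps)
  ultimately have "2 * (real m * D * ?K) * (real m * D) \<ge> 2 * ?d * (real m * D)\<^sup>2"
    by simp
  moreover have "2 * (E * K) * E - 2 * d * E\<^sup>2 = 2 * (K - d) * E\<^sup>2" for E K d :: real
    by (simp add: power2_eq_square algebra_simps)
  ultimately have "2 * (?K - ?d) * (real m * D)\<^sup>2 \<ge> 0"
    by (metis diff_ge_0_iff_ge)
  then have "?K - ?d \<ge> 0"
    using D m by (simp add: zero_le_mult_iff)
  \<comment> \<open>The difference of the two sides is \<open>- (m - 1) * (m + 2) / 2\<close>; the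
    remaining terms of \<open>?K\<close> are nonpositive, so the growth bound is
    contradicted.\<close>
  moreover have "(real m - 1) * (4 - real m) / 2 < ?d"
  proof -
    have "(real m - 1) * (4 - real m) / 2 - 3 * (real m - 1) = - ((real m - 1) * (real m + 2) / 2)"
      by (simp add: field_simps)
    moreover have "(real m - 1) * (real m + 2) / 2 > 0" using m by simp
    moreover have "?d = 3 * (real m - 1)" using m by (simp add: of_nat_diff)
    moreover have "x < d" if "x - y = - z" "z > 0" "d = y" for x y z d :: real
      using that by linarith
    ultimately show ?thesis by blast
  qed
  moreover have False if "x - 8 * y - 8 * z - d \<ge> 0" "x < d" "y \<ge> 0" "z \<ge> 0" for x y z d :: real
    using that by linarith
  ultimately show False using zero_le_square[of a] zero_le_square[of b] by blast
qed

section \<open>Rotating to the pole, and vectors annihilated by singular matrices\<close>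

lemma rotation_to_pole:
  fixes x :: "real ^ 3"
  assumes "norm x = 1"
  obtains R :: "real ^ 3 ^ 3" where "orthogonal_matrix R" "det R = 1" "R *v vector [0, 0, 1] = x"
proof -
  have n: "norm (vector [0, 0, 1] :: real ^ 3) = 1"
    by (simp add: norm_vec_def L2_set_def sum_3 vector_3)
  have c: "2 \<le> CARD(3)" by simp
  obtain f :: "real ^ 3 \<Rightarrow> real ^ 3"
    where f: "orthogonal_transformation f" "det (matrix f) = 1" "f (vector [0, 0, 1]) = x"
    by (rule rotation_exists_1[OF c n assms])
  have "orthogonal_matrix (matrix f)"
    using f(1) unfolding orthogonal_transformation_matrix by blast
  moreover have "matrix f *v vector [0, 0, 1] = x"
    using f(3) matrix_vector_mul(2)[OF orthogonal_transformation_linear[OF f(1)]] by metis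
  ultimately show thesis using f(2) by (intro that)
qed

lemma orthogonal_matrix_norm:
  fixes R :: "real ^ 'n ^ 'n"
  assumes "orthogonal_matrix R"
  shows "norm (R *v y) = norm y"
proof -
  have "orthogonal_transformation ((*v) R)"
    using assms by (simp add: orthogonal_transformation_matrix matrix_of_matrix_vector_mul)
  then show ?thesis by (rule orthogonal_transformation_norm)
qed

lemma det_eq_0_kernel:
  fixes A :: "real ^ 'n ^ 'n"
  assumes "det A = 0"
  obtains a where "a \<noteq> 0" "A *v a = 0"
proof -
  have "\<not> (\<exists>B. B ** A = mat 1)"
    using assms invertible_det_nz[of A] by (simp add: invertible_left_inverse)
  then show thesis
    using that unfolding matrix_left_invertible_ker by blast
qed

text \<open>The matrix with rows \<open>u\<close>, \<open>v\<close>, \<open>w\<close> is singular,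
  and any nonzero kernel vector will do. It later selects the component of the map that vanishes to
  second order.\<close>

lemma common_orthogonal_vector:
  fixes u v w :: "real ^ 3"
  assumes "triple u v w = 0"
  obtains a where "a \<noteq> 0" "a \<bullet> u = 0" "a \<bullet> v = 0" "a \<bullet> w = 0"
proof -
  obtain a where "a \<noteq> 0" "(vector [u, v, w] :: real ^ 3 ^ 3) *v a = 0"
    using assms det_eq_0_kernel by (metis dot_cross_det triple_def)
  then show thesis
    by (intro that[of a])
      (simp_all add: vec_eq_iff forall_3 matrix_vector_mult_def inner_vec_def sum_3 vector_3 mult.commute)
qed

lemma det_jacobian_vanishes:
  fixes P :: "real ^ 3 \<Rightarrow> real ^ 3"
  assumes m: "m > 1" and P: "homogeneous_harmonic_polynomial_map m P"
  obtains x where "norm x = 1" "det (jacobian_matrix P x) = 0"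
proof -
  have "\<exists>x\<in>sphere 0 1. \<forall>y\<in>sphere 0 1. \<bar>det (jacobian_matrix P x)\<bar> \<le> \<bar>det (jacobian_matrix P y)\<bar>"
    by (intro continuous_attains_inf continuous_on_rabs continuous_on_det_jacobian_matrix[OF P]) auto
  then obtain x where x: "norm x = 1"
    and min: "\<And>y. norm y = 1 \<Longrightarrow> \<bar>det (jacobian_matrix P x)\<bar> \<le> \<bar>det (jacobian_matrix P y)\<bar>"
    by auto
  obtain R :: "real ^ 3 ^ 3" where R: "orthogonal_matrix R" "det R = 1" "R *v vector [0, 0, 1] = x"
    using rotation_to_pole[OF x] .
  \<comment> \<open>The determinant of the composition picks up the factor \<open>det R\<close>,
    which is 1 for a proper rotation, so the minimum is carried to the pole unchanged.\<close>
  have det: "det (jacobian_matrix (\<lambda>x. P (R *v x)) y) = det (jacobian_matrix P (R *v y))" for y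
    by (simp add: jacobian_matrix_compose[OF P] det_mul R)
  have "det (jacobian_matrix P x) = 0"
    using det_jacobian_pole_eq_0[OF m homogeneous_harmonic_polynomial_map_compose_orthogonal[OF P R(1)]] min
    by (simp add: det R orthogonal_matrix_norm[OF R(1)])
  with x show thesis by (rule that)
qed

subsection \<open>Nodal sectors at a zero of higher order\<close>

text \<open>In the tangent plane \<open>x $ 3 = 1\<close> at the pole this is the
  degree-\<open>n\<close> part of the form on the unit circle, hence the coefficient of
  \<open>r ^ n\<close> in polar coordinates.\<close>

definition angular_part :: "(nat \<Rightarrow> nat \<Rightarrow> real) \<Rightarrow> nat \<Rightarrow> real \<Rightarrow> real"
  where "angular_part d n \<theta> = (\<Sum>i\<le>n. d i (n - i) * (cos \<theta> ^ i * sin \<theta> ^ (n - i)))"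

definition polar_point :: "real \<Rightarrow> real \<Rightarrow> real ^ 3"
  where "polar_point r \<theta> = vector [r * cos \<theta>, r * sin \<theta>, 1]"

lemma ternary_form_polar:
  assumes "\<And>i j. i + j > m \<Longrightarrow> d i j = 0"
  shows "ternary_form m d (polar_point r \<theta>) = (\<Sum>n\<le>m. angular_part d n \<theta> * r ^ n)"
proof -
  let ?g = "\<lambda>i j. d i j * ((r * cos \<theta>) ^ i * (r * sin \<theta>) ^ j)"
  have "ternary_form m d (polar_point r \<theta>) = (\<Sum>(i, j)\<in>{..m} \<times> {..m}. ?g i j)"
    by (simp add: ternary_form_def polar_point_def vector_3 sum.cartesian_product)
  also have "\<dots> = (\<Sum>(i, j)\<in>{(i, j). i + j \<le> m}. ?g i j)"
    by (rule sum.mono_neutral_right) (use assms in force)+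
  also have "\<dots> = (\<Sum>n\<le>m. \<Sum>i\<le>n. ?g i (n - i))"
    by (rule sum.triangle_reindex_eq)
  also have "\<dots> = (\<Sum>n\<le>m. angular_part d n \<theta> * r ^ n)"
    unfolding angular_part_def sum_distrib_right
    by (intro sum.cong refl) (simp add: power_mult_distrib mult_ac flip: power_add)
  finally show ?thesis .
qed

text \<open>This is the planar Laplacian in polar coordinates: for a form of degree n with angular
  part g, the Laplacian on the unit circle is \<open>g'' + n\<^sup>2 * g\<close>. The first two
  summands of the second derivative are the Laplacian of the monomial.\<close>

lemma has_derivative2_cos_sin_monomial:
  fixes i j :: nat
  defines "u \<equiv> \<lambda>\<theta>. real j * (cos \<theta> ^ (i + 1) * sin \<theta> ^ (j - 1)) - real i * (cos \<theta> ^ (i - 1) * sin \<theta> ^ (j + 1))"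
  shows "((\<lambda>\<theta>. cos \<theta> ^ i * sin \<theta> ^ j) has_real_derivative u \<theta>) (at \<theta>)"
    and "(u has_real_derivative (real i * real (i - 1) * (cos \<theta> ^ (i - 2) * sin \<theta> ^ j)
      + real j * real (j - 1) * (cos \<theta> ^ i * sin \<theta> ^ (j - 2))
      - (real (i + j))\<^sup>2 * (cos \<theta> ^ i * sin \<theta> ^ j))) (at \<theta>)"
proof -
  show "((\<lambda>\<theta>. cos \<theta> ^ i * sin \<theta> ^ j) has_real_derivative u \<theta>) (at \<theta>)"
    unfolding u_def by (auto intro!: derivative_eq_intros)
  let ?c = "cos \<theta>" and ?s = "sin \<theta>"
  \<comment> \<open>The factors \<open>real k\<close> and \<open>real (k - 1)\<close> vanish exactly
    where the exponents are truncated.\<close>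
  have p1: "real k * (x ^ (k - 1) * x) = real k * x ^ k" for k :: nat and x :: real
    by (cases k) (auto simp: mult_ac)
  have p2: "real k * real (k - 1) * (x ^ (k - 2) * x\<^sup>2) = real k * real (k - 1) * x ^ k" for k :: nat and x :: real
  proof (cases "k \<le> 1")
    case False
    then have "k - 2 + 2 = k" by simp
    then have "x ^ (k - 2) * x\<^sup>2 = x ^ k" by (metis power_add)
    then show ?thesis by (simp only:)
  qed (auto simp: le_Suc_eq)
  have dc: "((\<lambda>\<theta>. cos \<theta> ^ k) has_real_derivative real k * cos \<theta> ^ (k - 1) * (- sin \<theta>)) (at \<theta>)"
    and ds: "((\<lambda>\<theta>. sin \<theta> ^ k) has_real_derivative real k * sin \<theta> ^ (k - 1) * cos \<theta>) (at \<theta>)" for k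
    by (auto intro!: derivative_eq_intros)
  have "(u has_real_derivative
      real j * ((real (i + 1) * ?c ^ i * (- ?s)) * ?s ^ (j - 1) + ?c ^ (i + 1) * (real (j - 1) * ?s ^ (j - 2) * ?c))
      - real i * ((real (i - 1) * ?c ^ (i - 2) * (- ?s)) * ?s ^ (j + 1) + ?c ^ (i - 1) * (real (j + 1) * ?s ^ j * ?c))) (at \<theta>)"
    unfolding u_def
    by (rule DERIV_cong[OF DERIV_diff[OF DERIV_cmult[OF DERIV_mult[OF dc ds]] DERIV_cmult[OF DERIV_mult[OF dc ds]]]])
      (simp add: numeral_2_eq_2 algebra_simps)
  also have "real j * ((real (i + 1) * ?c ^ i * (- ?s)) * ?s ^ (j - 1) + ?c ^ (i + 1) * (real (j - 1) * ?s ^ (j - 2) * ?c))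
      - real i * ((real (i - 1) * ?c ^ (i - 2) * (- ?s)) * ?s ^ (j + 1) + ?c ^ (i - 1) * (real (j + 1) * ?s ^ j * ?c))
    = real i * real (i - 1) * ?c ^ (i - 2) * ?s ^ j * ?s\<^sup>2
      + real j * real (j - 1) * ?c ^ i * ?c\<^sup>2 * ?s ^ (j - 2)
      - real (i + 1) * ?c ^ i * (real j * (?s ^ (j - 1) * ?s))
      - real (j + 1) * ?s ^ j * (real i * (?c ^ (i - 1) * ?c))"
    by (simp add: algebra_simps power2_eq_square)
  also have "\<dots> = real i * real (i - 1) * (?c ^ (i - 2) * ?s ^ j) - (real i * real (i - 1) * (?c ^ (i - 2) * ?c\<^sup>2)) * ?s ^ j
      + real j * real (j - 1) * (?c ^ i * ?s ^ (j - 2)) - ?c ^ i * (real j * real (j - 1) * (?s ^ (j - 2) * ?s\<^sup>2))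
      - (real j * real (i + 1) + real i * real (j + 1)) * (?c ^ i * ?s ^ j)"
    unfolding p1 by (simp add: sin_squared_eq algebra_simps)
  also have "\<dots> = real i * real (i - 1) * (?c ^ (i - 2) * ?s ^ j)
      + real j * real (j - 1) * (?c ^ i * ?s ^ (j - 2))
      - (real i * real (i - 1) + real j * real (j - 1) + real j * real (i + 1) + real i * real (j + 1)) * (?c ^ i * ?s ^ j)"
    unfolding p2 by (simp add: algebra_simps)
  also have "real i * real (i - 1) + real j * real (j - 1) + real j * real (i + 1) + real i * real (j + 1) = (real (i + j))\<^sup>2"
    by (cases i; cases j) (simp_all add: power2_eq_square algebra_simps)
  finally show "(u has_real_derivative (real i * real (i - 1) * (cos \<theta> ^ (i - 2) * sin \<theta> ^ j)
      + real j * real (j - 1) * (cos \<theta> ^ i * sin \<theta> ^ (j - 2))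
      - (real (i + j))\<^sup>2 * (cos \<theta> ^ i * sin \<theta> ^ j))) (at \<theta>)" .
qed

text \<open>The vector with components \<open>g\<close> and \<open>g' / k\<close> turns uniformly.
  Rotating it by \<open>k * \<theta>\<close> undoes this motion and gives the constant vector
  \<open>(u, v)\<close>, whose polar coordinates are the amplitude and the phase.\<close>

lemma harmonic_oscillator:
  fixes g g' :: "real \<Rightarrow> real"
  assumes g: "\<And>\<theta>. (g has_real_derivative g' \<theta>) (at \<theta>)"
    and g': "\<And>\<theta>. (g' has_real_derivative - (k\<^sup>2 * g \<theta>)) (at \<theta>)" and k: "k \<noteq> 0"
  obtains A \<alpha> where "\<And>\<theta>. g \<theta> = A * cos (k * \<theta> - \<alpha>)"
proof -
  define u where "u \<theta> = g \<theta> * cos (k * \<theta>) - g' \<theta> * sin (k * \<theta>) / k" for \<theta>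
  define v where "v \<theta> = g \<theta> * sin (k * \<theta>) + g' \<theta> * cos (k * \<theta>) / k" for \<theta>
  have "(u has_real_derivative 0) (at \<theta>)" "(v has_real_derivative 0) (at \<theta>)" for \<theta>
    unfolding u_def v_def using k
    by (auto intro!: derivative_eq_intros g g' simp: field_simps power2_eq_square)
  then have uv: "u \<theta> = u 0" "v \<theta> = v 0" for \<theta>
    using DERIV_isconst_all by metis+
  obtain A \<alpha> where A: "u 0 = A * cos \<alpha>" "v 0 = A * sin \<alpha>" using polar_Ex by blast
  have "g \<theta> = A * cos (k * \<theta> - \<alpha>)" for \<theta>
  proof -
    have "(x * c - y * s / k) * c + (x * s + y * c / k) * s = x * (c * c + s * s)" for x y c s :: real
      by (simp add: algebra_simps)
    from this[of "g \<theta>" "cos (k * \<theta>)" "g' \<theta>" "sin (k * \<theta>)"]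
    have "g \<theta> = u \<theta> * cos (k * \<theta>) + v \<theta> * sin (k * \<theta>)"
      by (simp add: u_def v_def)
    also have "\<dots> = A * cos (k * \<theta> - \<alpha>)"
      by (simp add: uv[of \<theta>] A cos_diff algebra_simps)
    finally show ?thesis .
  qed
  then show thesis by (rule that)
qed

lemma sum_atMost_Suc_Suc:
  fixes f :: "nat \<Rightarrow> real"
  shows "(\<Sum>i\<le>Suc (Suc l). f i) = f 0 + f 1 + (\<Sum>i\<le>l. f (i + 2))"
  by (subst sum.atMost_Suc_shift, subst sum.atMost_Suc_shift) simp

text \<open>The recurrence expresses the planar Laplacian of the degree-\<open>n\<close> part as a
  multiple of the part of degree \<open>n - 2\<close>. When the latter vanishes, the
  degree-\<open>n\<close> part is a planar harmonic form, and its angular part satisfies the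
  oscillator equation with frequency \<open>n\<close>.\<close>

lemma angular_part_ode:
  assumes rec: "\<And>i j. real (i + 2) * real (i + 1) * d (i + 2) j + real (j + 2) * real (j + 1) * d i (j + 2)
      + (real m - real i - real j) * (real m - real i - real j - 1) * d i j = 0"
    and n: "n \<ge> 2" and low: "\<And>\<theta>. angular_part d (n - 2) \<theta> = 0"
  obtains A \<alpha> where "\<And>\<theta>. angular_part d n \<theta> = A * cos (real n * \<theta> - \<alpha>)"
proof -
  obtain l where l: "n = Suc (Suc l)" using le_Suc_ex[OF n] by auto
  define g' where "g' \<theta> = (\<Sum>i\<le>n. d i (n - i) * (real (n - i) * (cos \<theta> ^ (i + 1) * sin \<theta> ^ (n - i - 1))
     - real i * (cos \<theta> ^ (i - 1) * sin \<theta> ^ (n - i + 1))))" for \<theta>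
  have 1: "(angular_part d n has_real_derivative g' \<theta>) (at \<theta>)" for \<theta>
    unfolding angular_part_def[abs_def] g'_def
    by (intro DERIV_sum DERIV_cmult has_derivative2_cos_sin_monomial(1))
  have "(g' has_real_derivative - ((real n)\<^sup>2 * angular_part d n \<theta>)) (at \<theta>)" for \<theta>
  proof -
    let ?c = "cos \<theta>" and ?s = "sin \<theta>"
    have "(g' has_real_derivative (\<Sum>i\<le>n. d i (n - i) * (real i * real (i - 1) * (?c ^ (i - 2) * ?s ^ (n - i))
      + real (n - i) * real (n - i - 1) * (?c ^ i * ?s ^ (n - i - 2))
      - (real (i + (n - i)))\<^sup>2 * (?c ^ i * ?s ^ (n - i))))) (at \<theta>)"
      unfolding g'_def[abs_def]
      by (intro DERIV_sum DERIV_cmult has_derivative2_cos_sin_monomial(2))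
    also have "(\<Sum>i\<le>n. d i (n - i) * (real i * real (i - 1) * (?c ^ (i - 2) * ?s ^ (n - i))
        + real (n - i) * real (n - i - 1) * (?c ^ i * ?s ^ (n - i - 2))
        - (real (i + (n - i)))\<^sup>2 * (?c ^ i * ?s ^ (n - i))))
      = (\<Sum>i\<le>n. d i (n - i) * real i * real (i - 1) * ?c ^ (i - 2) * ?s ^ (n - i))
      + (\<Sum>i\<le>n. d i (n - i) * real (n - i) * real (n - i - 1) * ?c ^ i * ?s ^ (n - i - 2))
      - (real n)\<^sup>2 * angular_part d n \<theta>"
    proof -
      have "x * (y + z - w * v) = x * y + x * z - w * (x * v)" for x y z w v :: real
        by (simp add: algebra_simps)
      then show ?thesis
        by (simp add: angular_part_def sum_distrib_left sum.distrib sum_subtractf mult.assoc)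
    qed
    also have "(\<Sum>i\<le>n. d i (n - i) * real i * real (i - 1) * ?c ^ (i - 2) * ?s ^ (n - i))
      = (\<Sum>i\<le>n - 2. real (i + 2) * real (i + 1) * d (i + 2) (n - 2 - i) * (?c ^ i * ?s ^ (n - 2 - i)))"
    proof -
      show ?thesis unfolding l sum_atMost_Suc_Suc by (simp add: mult_ac)
    qed
    also have "(\<Sum>i\<le>n. d i (n - i) * real (n - i) * real (n - i - 1) * ?c ^ i * ?s ^ (n - i - 2))
      = (\<Sum>i\<le>n - 2. real (n - 2 - i + 2) * real (n - 2 - i + 1) * d i (n - 2 - i + 2) * (?c ^ i * ?s ^ (n - 2 - i)))"
    proof -
      show ?thesis unfolding l
        by (simp add: Suc_diff_le mult_ac add_diff_eq)
    qed
    \<comment> \<open>The factor from the recurrence depends only on the total degree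
      \<open>n - 2\<close> of the indices, so it is common to all summands.\<close>
    also have "(\<Sum>i\<le>n - 2. real (i + 2) * real (i + 1) * d (i + 2) (n - 2 - i) * (?c ^ i * ?s ^ (n - 2 - i)))
       + (\<Sum>i\<le>n - 2. real (n - 2 - i + 2) * real (n - 2 - i + 1) * d i (n - 2 - i + 2) * (?c ^ i * ?s ^ (n - 2 - i)))
      = (\<Sum>i\<le>n - 2. - ((real m - real (n - 2)) * (real m - real (n - 2) - 1)) * (d i (n - 2 - i) * (?c ^ i * ?s ^ (n - 2 - i))))"
      unfolding sum.distrib[symmetric]
    proof (rule sum.cong[OF refl])
      fix i assume "i \<in> {..n - 2}"
      then have e: "real m - real i - real (n - 2 - i) = real m - real (n - 2)" by (simp add: of_nat_diff)
      have r: "x * z + y * z = - w * (v * z)" if "x + y + w * v = 0" for x y z w v :: real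
        using that by algebra
      show "real (i + 2) * real (i + 1) * d (i + 2) (n - 2 - i) * (?c ^ i * ?s ^ (n - 2 - i))
         + real (n - 2 - i + 2) * real (n - 2 - i + 1) * d i (n - 2 - i + 2) * (?c ^ i * ?s ^ (n - 2 - i))
        = - ((real m - real (n - 2)) * (real m - real (n - 2) - 1)) * (d i (n - 2 - i) * (?c ^ i * ?s ^ (n - 2 - i)))"
        by (rule r) (use rec[of i "n - 2 - i"] in \<open>simp only: e\<close>)
    qed
    also have "\<dots> = - ((real m - real (n - 2)) * (real m - real (n - 2) - 1)) * angular_part d (n - 2) \<theta>"
      by (simp only: angular_part_def sum_distrib_left)
    finally show ?thesis by (simp add: low)
  qed
  from harmonic_oscillator[OF 1 this] show thesis
    using n that by auto
qed

text \<open>Dividing by \<open>r ^ k\<close> leaves a polynomial with value \<open>b k\<close> at 0,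
  and its sign persists for small positive \<open>r\<close>. The truncated exponents for
  \<open>n < k\<close> carry zero coefficients.\<close>

lemma lowest_term_sign:
  fixes b :: "nat \<Rightarrow> real"
  assumes low: "\<And>n. n < k \<Longrightarrow> b n = 0" and "b k \<noteq> 0" "k \<le> m"
  shows "\<forall>\<^sub>F r in at_right 0. (\<Sum>n\<le>m. b n * r ^ n) * b k > 0"
proof -
  define h where "h r = (\<Sum>n\<le>m. b n * r ^ (n - k))" for r
  have h: "r ^ k * h r = (\<Sum>n\<le>m. b n * r ^ n)" for r
    unfolding h_def sum_distrib_left
  proof (rule sum.cong[OF refl])
    fix n
    show "r ^ k * (b n * r ^ (n - k)) = b n * r ^ n"
      by (cases "n < k") (auto simp: low mult.left_commute simp flip: power_add)
  qed
  have "h 0 = b k"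
  proof -
    have "h 0 = (\<Sum>n\<le>m. if n = k then b n else 0)"
      unfolding h_def by (rule sum.cong) (auto simp: low power_0_left)
    then show ?thesis using \<open>k \<le> m\<close> by simp
  qed
  moreover have "isCont (\<lambda>r. h r * b k) 0"
    unfolding h_def by (intro continuous_intros)
  ultimately have "((\<lambda>r. h r * b k) \<longlongrightarrow> b k * b k) (at_right 0)"
    by (auto simp: isCont_def filterlim_at_split)
  moreover have "b k * b k > 0" using assms(2) by (metis not_real_square_gt_zero)
  ultimately have "\<forall>\<^sub>F r in at_right 0. h r * b k > 0"
    by (rule order_tendstoD(1))
  moreover have "\<forall>\<^sub>F r in at_right 0. r > (0::real)" by (rule eventually_at_right_less)
  ultimately show ?thesis
  proof eventually_elim
    case (elim r)
    then have "r ^ k * (h r * b k) > 0" by simp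
    then show ?case by (simp add: mult.assoc flip: h)
  qed
qed

lemma zero_between_opposite_signs:
  fixes f :: "real \<Rightarrow> real"
  assumes "a < b" "continuous_on {a..b} f" "f a * f b < 0"
  obtains x where "a < x" "x < b" "f x = 0"
proof -
  have "\<exists>x\<ge>a. x \<le> b \<and> f x = 0"
  proof (cases "f a < 0")
    case True
    then show ?thesis using assms by (intro IVT') (auto simp: mult_less_0_iff)
  next
    case False
    then show ?thesis using assms by (intro IVT2') (auto simp: mult_less_0_iff)
  qed
  then obtain x where "a \<le> x" "x \<le> b" "f x = 0" by blast
  with assms(3) show thesis by (intro that[of x]) (auto simp: less_le)
qed

text \<open>Let \<open>k\<close> be the lowest degree with a nonzero angular part;
  \<open>double\<close> makes it at least 2. On the rays where the cosine is 1 and -1 alternately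
  this part fixes the sign of \<open>f\<close> close to the pole, and the intermediate value theorem
  gives zeros between neighbouring rays. Four rays span an angle of at most
  \<open>3 * pi / 2\<close>, so the three sectors do not overlap.\<close>

lemma nodal_sectors:
  fixes d :: "nat \<Rightarrow> nat \<Rightarrow> real" and m :: nat
  defines "f \<equiv> ternary_form m d"
  assumes d0: "\<And>i j. i + j > m \<Longrightarrow> d i j = 0"
    and rec: "\<And>i j. real (i + 2) * real (i + 1) * d (i + 2) j + real (j + 2) * real (j + 1) * d i (j + 2)
      + (real m - real i - real j) * (real m - real i - real j - 1) * d i j = 0"
    and double: "d 0 0 = 0" "d 1 0 = 0" "d 0 1 = 0"
    and nontrivial: "angular_part d n' \<theta>' \<noteq> 0"
  obtains k \<theta>0 \<rho> where "k \<ge> 2" "\<rho> > 0"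
    "\<And>r j. 0 < r \<Longrightarrow> r < \<rho> \<Longrightarrow> j \<le> 3 \<Longrightarrow> f (polar_point r (\<theta>0 + real j * pi / real k)) \<noteq> 0"
    "\<And>r j. 0 < r \<Longrightarrow> r < \<rho> \<Longrightarrow> j \<le> 2 \<Longrightarrow>
       \<exists>\<theta>. real j * pi / real k < \<theta> \<and> \<theta> < real (j + 1) * pi / real k \<and> f (polar_point r (\<theta>0 + \<theta>)) = 0"
proof -
  define k where "k = (LEAST n. \<exists>\<theta>. angular_part d n \<theta> \<noteq> 0)"
  have ex: "\<exists>\<theta>. angular_part d k \<theta> \<noteq> 0"
    unfolding k_def by (rule LeastI[of _ n']) (use nontrivial in blast)
  have low: "angular_part d n \<theta> = 0" if "n < k" for n \<theta>
    using not_less_Least[of n "\<lambda>n. \<exists>\<theta>. angular_part d n \<theta> \<noteq> 0"] that by (auto simp: k_def)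
  have "angular_part d 0 \<theta> = 0" "angular_part d 1 \<theta> = 0" for \<theta>
    using double by (simp_all add: angular_part_def)
  then have "k \<noteq> 0" "k \<noteq> 1" using ex by metis+
  then have k: "k \<ge> 2" by simp
  have "angular_part d n \<theta> = 0" if "n > m" for n \<theta>
    using that d0 by (simp add: angular_part_def)
  then have km: "k \<le> m" using ex by (meson not_le)
  obtain A \<alpha> where g: "\<And>\<theta>. angular_part d k \<theta> = A * cos (real k * \<theta> - \<alpha>)"
    using angular_part_ode[OF rec k low] k by auto
  have A: "A \<noteq> 0" using ex g by auto
  define \<beta> where "\<beta> j = \<alpha> / real k + real j * pi / real k" for j :: nat
  have g\<beta>: "angular_part d k (\<beta> j) = A * (-1) ^ j" for j
  proof -
    have "real k * \<beta> j - \<alpha> = real j * pi" using k by (simp add: \<beta>_def field_simps)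
    then show ?thesis by (simp add: g cos_npi)
  qed
  have fp: "f (polar_point r \<theta>) = (\<Sum>n\<le>m. angular_part d n \<theta> * r ^ n)" for r \<theta>
    unfolding f_def by (rule ternary_form_polar[OF d0])
  have "\<forall>\<^sub>F r in at_right 0. f (polar_point r (\<beta> j)) * (A * (-1) ^ j) > 0" for j
    using lowest_term_sign[of k "\<lambda>n. angular_part d n (\<beta> j)" m] low A km by (simp add: fp g\<beta>)
  then have "\<forall>\<^sub>F r in at_right 0. \<forall>j\<in>{..3}. f (polar_point r (\<beta> j)) * (A * (-1) ^ j) > 0"
    by (intro eventually_ball_finite) auto
  then obtain \<rho> where \<rho>: "\<rho> > 0"
    and sgn: "\<And>r j. 0 < r \<Longrightarrow> r < \<rho> \<Longrightarrow> j \<le> 3 \<Longrightarrow> f (polar_point r (\<beta> j)) * (A * (-1) ^ j) > 0"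
    unfolding eventually_at_right_field by auto
  show thesis
  proof (rule that[of k \<rho> "\<alpha> / real k"])
    show "f (polar_point r (\<alpha> / real k + real j * pi / real k)) \<noteq> 0" if "0 < r" "r < \<rho>" "j \<le> 3" for r j
      using sgn[OF that] by (auto simp: \<beta>_def)
    show "\<exists>\<theta>. real j * pi / real k < \<theta> \<and> \<theta> < real (j + 1) * pi / real k \<and> f (polar_point r (\<alpha> / real k + \<theta>)) = 0"
      if r: "0 < r" "r < \<rho>" and j: "j \<le> 2" for r j
    proof -
      have "f (polar_point r (\<beta> j)) * f (polar_point r (\<beta> (j + 1))) < 0"
        using sgn[OF r, of j] sgn[OF r, of "j + 1"] j
        by (auto simp: zero_less_mult_iff mult_less_0_iff)
      moreover have "continuous_on S (\<lambda>\<theta>. f (polar_point r (\<alpha> / real k + \<theta>)))" for S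
        unfolding fp angular_part_def by (intro continuous_intros)
      moreover have "real j * pi / real k < real (j + 1) * pi / real k"
        using k by (simp add: divide_strict_right_mono)
      ultimately show ?thesis
        using zero_between_opposite_signs[of "real j * pi / real k" "real (j + 1) * pi / real k"
          "\<lambda>\<theta>. f (polar_point r (\<alpha> / real k + \<theta>))"] by (metis \<beta>_def)
    qed
  qed (use k \<rho> in auto)
qed

section \<open>The zero cone of an injective map near the pole\<close>

lemma curve_meets_two_sectors_only:
  fixes \<zeta> :: "real \<Rightarrow> complex"
  assumes cont: "continuous_on {-\<epsilon><..<\<epsilon>} \<zeta>"
    and avoid: "\<And>t. \<bar>t\<bar> < \<epsilon> \<Longrightarrow> t \<noteq> 0 \<Longrightarrow> Arg2pi (\<zeta> t) \<notin> {0, \<beta>1, \<beta>2}"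
    and t: "\<bar>t1\<bar> < \<epsilon>" "t1 \<noteq> 0" "\<bar>t2\<bar> < \<epsilon>" "t2 \<noteq> 0" "\<bar>t3\<bar> < \<epsilon>" "t3 \<noteq> 0"
    and A: "Arg2pi (\<zeta> t1) < \<beta>1" "\<beta>1 < Arg2pi (\<zeta> t2)" "Arg2pi (\<zeta> t2) < \<beta>2" "\<beta>2 < Arg2pi (\<zeta> t3)"
  shows False
proof -
  \<comment> \<open>On an interval that omits 0 the argument is continuous, so passing from one
    sector to another would make it take the separating value.\<close>
  have separated: False
    if I: "connected I" "I \<subseteq> {-\<epsilon><..<\<epsilon>} - {0}" and st: "s \<in> I" "u \<in> I"
      and b: "\<beta> \<in> {\<beta>1, \<beta>2}" "Arg2pi (\<zeta> s) < \<beta>" "\<beta> < Arg2pi (\<zeta> u)" for I s u \<beta>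
  proof -
    have "continuous_on I (\<lambda>t. Arg2pi (\<zeta> t))"
    proof (rule continuous_on_compose2[of "- \<real>\<^sub>\<ge>\<^sub>0" Arg2pi])
      show "continuous_on (- \<real>\<^sub>\<ge>\<^sub>0) Arg2pi"
        by (intro continuous_at_imp_continuous_on ballI continuous_at_Arg2pi) auto
      show "continuous_on I \<zeta>" using cont I(2) by (auto intro: continuous_on_subset)
      \<comment> \<open>Omitting the argument 0 keeps the curve off the branch cut of
        \<open>Arg2pi\<close>; this includes the origin, as \<open>Arg2pi 0 = 0\<close>.\<close>
      show "\<zeta> ` I \<subseteq> - \<real>\<^sub>\<ge>\<^sub>0"
      proof clarsimp
        fix t assume "t \<in> I" "\<zeta> t \<in> \<real>\<^sub>\<ge>\<^sub>0"
        then show False using avoid[of t] I(2)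
          by (force simp: Arg2pi_eq_0 complex_nonneg_Reals_iff complex_is_Real_iff)
      qed
    qed
    then have "connected ((\<lambda>t. Arg2pi (\<zeta> t)) ` I)" using I(1) by (rule connected_continuous_image)
    then have "{Arg2pi (\<zeta> s)..Arg2pi (\<zeta> u)} \<subseteq> (\<lambda>t. Arg2pi (\<zeta> t)) ` I"
      by (rule connected_contains_Icc) (use st in auto)
    moreover have "\<beta> \<in> {Arg2pi (\<zeta> s)..Arg2pi (\<zeta> u)}" using b by simp
    ultimately have "\<beta> \<in> (\<lambda>t. Arg2pi (\<zeta> t)) ` I" by (rule subsetD)
    then obtain t where "t \<in> I" "Arg2pi (\<zeta> t) = \<beta>" by auto
    then show False using avoid[of t] b(1) I(2) by force
  qed
  have neg: "connected {-\<epsilon><..<0}" "{-\<epsilon><..<0} \<subseteq> {-\<epsilon><..<\<epsilon>} - {0}"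
    and pos: "connected {0<..<\<epsilon>}" "{0<..<\<epsilon>} \<subseteq> {-\<epsilon><..<\<epsilon>} - {0}"
    using t(1) by auto
  have mem: "s \<in> {-\<epsilon><..<0} \<or> s \<in> {0<..<\<epsilon>}" if "\<bar>s\<bar> < \<epsilon>" "s \<noteq> 0" for s
    using that by auto
  have A13: "Arg2pi (\<zeta> t1) < \<beta>2" using A by simp
  \<comment> \<open>Two of the three parameters lie on the same side of 0, and their sectors are
    separated by \<open>\<beta>1\<close> or \<open>\<beta>2\<close>.\<close>
  show False
    using mem[OF t(1,2)] mem[OF t(3,4)] mem[OF t(5,6)] A A13
      separated[OF neg, of t1 t2 \<beta>1] separated[OF neg, of t2 t3 \<beta>2] separated[OF neg, of t1 t3 \<beta>2]
      separated[OF pos, of t1 t2 \<beta>1] separated[OF pos, of t2 t3 \<beta>2] separated[OF pos, of t1 t3 \<beta>2]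
    by blast
qed

text \<open>The complex number is the central projection of \<open>x\<close> to the plane
  \<open>x $ 3 = 1\<close>, turned so that the ray at angle \<open>\<theta>0\<close> becomes the
  branch cut of \<open>Arg2pi\<close>.\<close>

lemma vec_polar_point:
  fixes x :: "real ^ 3"
  assumes "x $ 3 > 0"
  shows "x = x $ 3 *\<^sub>R polar_point (cmod (Complex (x $ 1 / x $ 3) (x $ 2 / x $ 3) * cis (- \<theta>0)))
    (\<theta>0 + Arg2pi (Complex (x $ 1 / x $ 3) (x $ 2 / x $ 3) * cis (- \<theta>0)))"
proof -
  define z where "z = Complex (x $ 1 / x $ 3) (x $ 2 / x $ 3)"
  define w where "w = z * cis (- \<theta>0)"
  have "w = of_real (cmod w) * cis (Arg2pi w)"
    using Arg2pi_eq[of w] by (simp add: cis_conv_exp mult.commute)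
  moreover have "z = w * cis \<theta>0" by (simp add: w_def cis_mult mult.assoc)
  ultimately have "z = of_real (cmod w) * cis (\<theta>0 + Arg2pi w)"
    by (metis add.commute cis_mult mult.assoc)
  then have "x $ 1 / x $ 3 = cmod w * cos (\<theta>0 + Arg2pi w)" "x $ 2 / x $ 3 = cmod w * sin (\<theta>0 + Arg2pi w)"
    unfolding z_def by (simp_all add: complex_eq_iff)
  then show ?thesis
    using assms unfolding z_def[symmetric] w_def[symmetric] polar_point_def
    by (simp add: vec_eq_iff forall_3 vector_3 field_simps)
qed

lemma Arg2pi_polar_point:
  fixes x :: "real ^ 3"
  assumes "x = s *\<^sub>R polar_point r (\<theta>0 + \<theta>)" "s > 0" "r > 0" "0 < \<theta>" "\<theta> < 2 * pi"
  shows "Arg2pi (Complex (x $ 1 / x $ 3) (x $ 2 / x $ 3) * cis (- \<theta>0)) = \<theta>"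
proof -
  have "Complex (x $ 1 / x $ 3) (x $ 2 / x $ 3) = of_real r * cis (\<theta>0 + \<theta>)"
    using assms by (simp add: polar_point_def vector_3 complex_eq_iff)
  then have "Complex (x $ 1 / x $ 3) (x $ 2 / x $ 3) * cis (- \<theta>0) = of_real r * exp (\<i> * of_real \<theta>)"
    by (simp add: cis_mult mult.assoc flip: cis_conv_exp)
  then show ?thesis using Arg2pi_unique[of r \<theta>] assms by simp
qed

text \<open>Cramer's rule for the basis \<open>a\<close>, \<open>p\<close>, \<open>b\<close> has
  determinant \<open>b \<bullet> b\<close>. The coordinate along \<open>a\<close> is proportional to
  \<open>(a \<bullet> w) * (p \<bullet> p) - (a \<bullet> p) * (w \<bullet> p)\<close>, which is 0
  here.\<close>

lemma plane_decomposition: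
  fixes a p w :: "real ^ 3"
  defines "b \<equiv> cross3 a p"
  assumes "a \<bullet> p = 0" "a \<bullet> w = 0" "b \<noteq> 0"
  shows "w = (triple a w b / (b \<bullet> b)) *\<^sub>R p + (triple a p w / (b \<bullet> b)) *\<^sub>R b"
proof -
  have "triple a p b = b \<bullet> b"
    by (simp add: triple_def b_def cross3_simps)
  moreover have "triple w p b = (a \<bullet> w) * (p \<bullet> p) - (a \<bullet> p) * (w \<bullet> p)"
    by (simp add: triple_def b_def cross3_simps)
  ultimately have "(b \<bullet> b) *\<^sub>R w = triple a w b *\<^sub>R p + triple a p w *\<^sub>R b"
    using cramer_triple[of a p b w] assms by simp
  then have "w = (1 / (b \<bullet> b)) *\<^sub>R (triple a w b *\<^sub>R p + triple a p w *\<^sub>R b)"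
    using assms(4) by (metis divide_self_if inner_eq_zero_iff scaleR_one scaleR_scaleR times_divide_eq_left mult_1)
  then show ?thesis by (simp add: scaleR_add_right)
qed

lemma not_inj_if_det_jacobian_pole_eq_0:
  fixes P :: "real ^ 3 \<Rightarrow> real ^ 3"
  assumes m: "m > 1" and P: "homogeneous_harmonic_polynomial_map m P"
    and J: "det (jacobian_matrix P (vector [0, 0, 1])) = 0"
  shows "\<not> inj P"
proof
  assume inj: "inj P"
  obtain c where c0: "\<And>n i j. i + j > m \<Longrightarrow> c n i j = 0" and Pc: "\<And>n. (\<lambda>x. P x $ n) = ternary_form m (c n)"
    and rec_c: "\<And>n i j. real (i + 2) * real (i + 1) * c n (i + 2) j + real (j + 2) * real (j + 1) * c n i (j + 2)
      + (real m - real i - real j) * (real m - real i - real j - 1) * c n i j = 0"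
    using harmonic_map_coefficients[OF P] by blast
  define C :: "nat \<Rightarrow> nat \<Rightarrow> real ^ 3" where "C i j = (\<chi> n. c n i j)" for i j
  have "det (jacobian_matrix P (vector [0, 0, 1])) = triple (C 1 0) (C 0 1) (real m *\<^sub>R C 0 0)"
  proof -
    have "(\<chi> n. partial_deriv 1 (ternary_form m (c n)) (vector [0, 0, 1])) = C 1 0"
      "(\<chi> n. partial_deriv 2 (ternary_form m (c n)) (vector [0, 0, 1])) = C 0 1"
      "(\<chi> n. partial_deriv 3 (ternary_form m (c n)) (vector [0, 0, 1])) = real m *\<^sub>R C 0 0"
      using m by (simp_all add: partial_deriv_ternary_form_line_1[OF c0] poly_0_coeff_0 coeff_truncated_poly c0
          C_def vec_eq_iff)
    then show ?thesis by (simp add: jacobian_matrix_def det_columns Pc)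
  qed
  then have "triple (C 1 0) (C 0 1) (C 0 0) = 0" using J m by simp
  then obtain a where a: "a \<noteq> 0" "a \<bullet> C 1 0 = 0" "a \<bullet> C 0 1 = 0" "a \<bullet> C 0 0 = 0"
    by (rule common_orthogonal_vector)
  \<comment> \<open>These are the coefficients of the component \<open>a \<bullet> P\<close>. The
    choice of \<open>a\<close> removes those of order 0 and 1 at the pole, and linearity passes the
    recurrence on to \<open>d\<close>.\<close>
  define d where "d i j = a \<bullet> C i j" for i j
  define f where "f x = a \<bullet> P x" for x
  have f: "f = ternary_form m d"
  proof
    fix x
    have "P x $ n = ternary_form m (c n) x" for n using Pc by metis
    then show "f x = ternary_form m d x"
      by (simp add: f_def d_def C_def ternary_form_def inner_vec_def sum_3 sum_distrib_left sum.distrib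
          distrib_right mult.assoc)
  qed
  have d0: "d i j = 0" if "i + j > m" for i j
    using c0[OF that] by (simp add: d_def C_def inner_vec_def)
  have rec: "real (i + 2) * real (i + 1) * d (i + 2) j + real (j + 2) * real (j + 1) * d i (j + 2)
      + (real m - real i - real j) * (real m - real i - real j - 1) * d i j = 0" for i j
  proof -
    have "real (i + 2) * real (i + 1) * d (i + 2) j + real (j + 2) * real (j + 1) * d i (j + 2)
        + (real m - real i - real j) * (real m - real i - real j - 1) * d i j
      = (\<Sum>n\<in>UNIV. a $ n * (real (i + 2) * real (i + 1) * c n (i + 2) j + real (j + 2) * real (j + 1) * c n i (j + 2)
        + (real m - real i - real j) * (real m - real i - real j - 1) * c n i j))"
      by (simp only: d_def C_def inner_vec_def inner_real_def vec_lambda_beta distrib_left sum.distrib sum_distrib_left mult_ac)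
    also have "\<dots> = 0"
      by (simp only: rec_c mult_zero_right sum.neutral_const)
    finally show ?thesis .
  qed
  have f_scale: "f (s *\<^sub>R x) = s ^ m * f x" for s x
    by (simp add: f_def homogeneous_harmonic_polynomial_map_scaleR[OF P])
  have contP: "continuous_on S P" for S by (rule homogeneous_harmonic_polynomial_map_continuous_on[OF P])
  \<comment> \<open>Otherwise \<open>f\<close> vanishes on the open upper half space, whose image is
    open by invariance of domain but would lie in the plane orthogonal to \<open>a\<close>. The
    point \<open>?y\<close> leaves that plane within the image.\<close>
  have "\<exists>n \<theta>. angular_part d n \<theta> \<noteq> 0"
  proof (rule ccontr)
    assume "\<not> ?thesis"
    then have fp: "f (polar_point r \<theta>) = 0" for r \<theta>
      by (simp add: f ternary_form_polar[OF d0])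
    let ?U = "{x :: real ^ 3. x $ 3 > 0}"
    have f0: "f x = 0" if "x \<in> ?U" for x
      using that vec_polar_point[of x 0] by (metis f_scale fp mem_Collect_eq mult_zero_right)
    have "open ?U" by (intro open_Collect_less continuous_intros)
    then have "open (P ` ?U)"
      using inj by (intro invariance_of_domain contP) (auto intro: inj_on_subset)
    moreover have "P (vector [0, 0, 1]) \<in> P ` ?U" by (simp add: vector_3)
    ultimately obtain \<epsilon> where \<epsilon>: "\<epsilon> > 0" "ball (P (vector [0, 0, 1])) \<epsilon> \<subseteq> P ` ?U"
      unfolding open_contains_ball by blast
    let ?y = "P (vector [0, 0, 1]) + (\<epsilon> / (2 * norm a)) *\<^sub>R a"
    have "?y \<in> ball (P (vector [0, 0, 1])) \<epsilon>" using \<epsilon>(1) a(1) by (simp add: dist_norm)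
    then have "a \<bullet> ?y = 0" using \<epsilon>(2) f0 by (auto simp: f_def)
    moreover have "a \<bullet> P (vector [0, 0, 1]) = 0" using f0[of "vector [0, 0, 1]"] by (simp add: f_def vector_3)
    ultimately show False using \<epsilon>(1) a(1) by (simp add: inner_add_right)
  qed
  then obtain n' \<theta>' where nontrivial: "angular_part d n' \<theta>' \<noteq> 0" by blast
  have double: "d 0 0 = 0" "d 1 0 = 0" "d 0 1 = 0" using a by (simp_all add: d_def)
  obtain k \<theta>0 \<rho> where k: "k \<ge> 2" and \<rho>: "\<rho> > 0"
    and rays: "\<And>r j. 0 < r \<Longrightarrow> r < \<rho> \<Longrightarrow> j \<le> 3 \<Longrightarrow> f (polar_point r (\<theta>0 + real j * pi / real k)) \<noteq> 0"
    and sectors: "\<And>r j. 0 < r \<Longrightarrow> r < \<rho> \<Longrightarrow> j \<le> 2 \<Longrightarrow>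
       \<exists>\<theta>. real j * pi / real k < \<theta> \<and> \<theta> < real (j + 1) * pi / real k \<and> f (polar_point r (\<theta>0 + \<theta>)) = 0"
    using nodal_sectors[OF d0 rec double nontrivial, folded f] by metis
  define e where "e = polar_point 0 0"
  define p where "p = P e"
  define b where "b = cross3 a p"
  have e: "e = vector [0, 0, 1]" by (simp add: e_def polar_point_def)
  have "P 0 = 0" using homogeneous_harmonic_polynomial_map_scaleR[OF P, of 0 0] m by (simp add: power_0_left)
  moreover have "e \<noteq> 0" by (simp add: e vec_eq_iff forall_3 vector_3)
  ultimately have "p \<noteq> 0" using inj by (metis p_def injD)
  have ap: "a \<bullet> p = 0"
  proof -
    have "f e = (\<Sum>n\<le>m. angular_part d n 0 * 0 ^ n)"
      unfolding e_def f by (rule ternary_form_polar) (rule d0)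
    also have "\<dots> = 0"
      by (rule sum.neutral) (simp add: power_0_left angular_part_def double)
    finally have "f e = 0" .
    then show ?thesis by (simp add: f_def p_def)
  qed
  have b: "b \<noteq> 0"
    unfolding b_def using norm_and_cross_eq_0[of a p] a(1) \<open>p \<noteq> 0\<close> ap by (auto simp: norm_and_cross_eq_0)
  have ab: "a \<bullet> b = 0" by (simp add: b_def dot_cross_self)
  obtain Q where Q: "homeomorphism UNIV (range P) P Q"
    using invariance_of_domain_homeomorphism[OF open_UNIV contP _ inj] by auto
  have openP: "open (range P)" using inj by (intro invariance_of_domain contP open_UNIV)
  have PQ: "P (Q y) = y" if "y \<in> range P" for y using Q that by (auto simp: homeomorphism_def)
  have QP: "Q (P x) = x" for x using Q by (simp add: homeomorphism_def)
  \<comment> \<open>The segment \<open>p + t *\<^sub>R b\<close> is orthogonal to \<open>a\<close>,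
    so its preimage \<open>\<gamma>\<close> consists of zeros of \<open>f\<close>;
    \<open>\<zeta>\<close> is its central projection to the tangent plane, with angles measured from
    the first ray.\<close>
  define \<gamma> where "\<gamma> t = Q (p + t *\<^sub>R b)" for t
  have \<gamma>0: "\<gamma> 0 = e" by (simp add: \<gamma>_def p_def QP)
  define \<zeta> where "\<zeta> t = Complex (\<gamma> t $ 1 / \<gamma> t $ 3) (\<gamma> t $ 2 / \<gamma> t $ 3) * cis (- \<theta>0)" for t
  have \<zeta>0: "\<zeta> 0 = 0" by (simp add: \<zeta>_def \<gamma>0 e vector_3 complex_eq_iff)
  let ?T = "{t. p + t *\<^sub>R b \<in> range P}"
  have openT: "open ?T"
    using open_vimage[OF openP, of "\<lambda>t. p + t *\<^sub>R b"]
    by (simp add: vimage_def continuous_on_add continuous_on_scaleR)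
  have T0: "0 \<in> ?T" by (simp add: p_def)
  have cont\<gamma>: "continuous_on ?T \<gamma>"
    unfolding \<gamma>_def
  proof (rule continuous_on_compose2[of "range P" Q])
    show "continuous_on (range P) Q" using Q by (simp add: homeomorphism_def)
    show "continuous_on ?T (\<lambda>t. p + t *\<^sub>R b)" by (intro continuous_intros)
  qed auto
  obtain \<epsilon> where \<epsilon>: "\<epsilon> > 0" and good: "\<And>t. \<bar>t\<bar> < \<epsilon> \<Longrightarrow> t \<in> ?T \<and> \<gamma> t $ 3 > 0 \<and> cmod (\<zeta> t) < \<rho>"
  proof -
    have 1: "isCont \<gamma> 0" using cont\<gamma> openT T0 by (simp add: continuous_on_eq_continuous_at)
    have 2: "isCont \<zeta> 0" unfolding \<zeta>_def Complex_eq using 1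
      by (intro continuous_intros) (auto simp: \<gamma>0 e vector_3)
    have "\<forall>\<^sub>F t in nhds 0. t \<in> ?T" using openT T0 by (rule eventually_nhds_in_open)
    moreover have "\<forall>\<^sub>F t in nhds 0. \<gamma> t $ 3 > 0"
    proof -
      have "isCont (\<lambda>t. \<gamma> t $ 3) 0" using 1 by (intro continuous_intros)
      then show ?thesis unfolding isCont_def continuous_at
        by (intro order_tendstoD(1)[of _ "\<gamma> 0 $ 3"]) (auto simp: tendsto_nhds_iff \<gamma>0 e vector_3)
    qed
    moreover have "\<forall>\<^sub>F t in nhds 0. cmod (\<zeta> t) < \<rho>"
    proof -
      have "isCont (\<lambda>t. cmod (\<zeta> t)) 0" using 2 by (intro continuous_intros)
      then show ?thesis unfolding isCont_def
        by (intro order_tendstoD(2)[of _ "cmod (\<zeta> 0)"]) (auto simp: tendsto_nhds_iff \<zeta>0 \<rho>)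
    qed
    ultimately have "\<forall>\<^sub>F t in nhds 0. t \<in> ?T \<and> \<gamma> t $ 3 > 0 \<and> cmod (\<zeta> t) < \<rho>"
      by eventually_elim auto
    then show thesis using that by (auto simp: eventually_nhds_metric dist_real_def)
  qed
  have P\<gamma>: "P (\<gamma> t) = p + t *\<^sub>R b" if "\<bar>t\<bar> < \<epsilon>" for t
    using good[OF that] PQ by (simp add: \<gamma>_def)
  have cont\<zeta>: "continuous_on {-\<epsilon><..<\<epsilon>} \<zeta>"
  proof -
    have "continuous_on {-\<epsilon><..<\<epsilon>} \<gamma>"
      by (rule continuous_on_subset[OF cont\<gamma>]) (use good in \<open>auto simp: abs_less_iff\<close>)
    then show ?thesis unfolding \<zeta>_def Complex_eq
      by (intro continuous_intros) (use good in \<open>force simp: abs_less_iff\<close>)+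
  qed
  have avoid: "Arg2pi (\<zeta> t) \<noteq> real j * pi / real k" if t: "\<bar>t\<bar> < \<epsilon>" "t \<noteq> 0" and j: "j \<le> 3" for t j
  proof
    assume eq: "Arg2pi (\<zeta> t) = real j * pi / real k"
    have \<gamma>t: "\<gamma> t = \<gamma> t $ 3 *\<^sub>R polar_point (cmod (\<zeta> t)) (\<theta>0 + Arg2pi (\<zeta> t))"
      unfolding \<zeta>_def using good[OF t(1)] by (intro vec_polar_point) simp
    have "f (\<gamma> t) = 0" using P\<gamma>[OF t(1)] by (simp add: f_def inner_add_right ap ab)
    then have "f (polar_point (cmod (\<zeta> t)) (\<theta>0 + Arg2pi (\<zeta> t))) = 0"
      using \<gamma>t good[OF t(1)] by (metis f_scale less_irrefl mult_eq_0_iff power_eq_0_iff)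
    \<comment> \<open>If \<open>\<zeta> t = 0\<close>, then \<open>\<gamma> t\<close> is a multiple
      of \<open>e\<close>, so by homogeneity its image is a multiple of \<open>p\<close>; the
      component \<open>t *\<^sub>R b\<close> orthogonal to \<open>p\<close> rules this out.\<close>
    moreover have "\<zeta> t \<noteq> 0"
    proof
      assume "\<zeta> t = 0"
      then have "\<gamma> t = \<gamma> t $ 3 *\<^sub>R e" using \<gamma>t by (simp add: e_def polar_point_def)
      then have "p + t *\<^sub>R b = (\<gamma> t $ 3) ^ m *\<^sub>R p"
        by (metis P\<gamma> homogeneous_harmonic_polynomial_map_scaleR[OF P] p_def t(1))
      then have "b \<bullet> (p + t *\<^sub>R b) = b \<bullet> ((\<gamma> t $ 3) ^ m *\<^sub>R p)" by simp
      then show False using b t(2) by (simp add: inner_add_right b_def dot_cross_self)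
    qed
    ultimately show False using rays[of "cmod (\<zeta> t)" j] good[OF t(1)] j eq by simp
  qed
  \<comment> \<open>On the plane orthogonal to \<open>a\<close> these are the coordinates along
    \<open>p\<close> and \<open>b\<close>. For \<open>S > 0\<close>, scaling by \<open>1 / S\<close>
    moves a point to the line through \<open>p\<close> in direction \<open>b\<close>, at parameter
    \<open>T / S\<close>.\<close>
  define S where "S w = triple a w b / (b \<bullet> b)" for w
  define T where "T w = triple a p w / (b \<bullet> b)" for w
  have contST: "isCont S w" "isCont T w" for w
    unfolding S_def T_def triple_def by (intro continuous_intros continuous_cross; simp add: b)+
  have Sp: "S p = 1" "T p = 0"
  proof -
    have "triple a p b = b \<bullet> b"
      by (simp add: triple_def b_def cross3_simps)
    then show "S p = 1" "T p = 0" using b by (simp_all add: S_def T_def)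
  qed
  obtain \<delta> where \<delta>: "\<delta> > 0" and near: "\<And>x. dist x e < \<delta> \<Longrightarrow> S (P x) > 0 \<and> \<bar>T (P x) / S (P x)\<bar> < \<epsilon>"
  proof -
    have "isCont P e" using contP[of UNIV] by (simp add: continuous_on_eq_continuous_at)
    then have lim: "((\<lambda>x. S (P x)) \<longlongrightarrow> 1) (nhds e)" "((\<lambda>x. T (P x)) \<longlongrightarrow> 0) (nhds e)"
      using isCont_o2[OF \<open>isCont P e\<close> contST(1)] isCont_o2[OF \<open>isCont P e\<close> contST(2)]
      by (simp_all add: isCont_def tendsto_nhds_iff Sp flip: p_def)
    have "((\<lambda>x. \<bar>T (P x) / S (P x)\<bar>) \<longlongrightarrow> \<bar>0 / 1\<bar>) (nhds e)"
      by (intro tendsto_intros lim) simp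
    then have "\<forall>\<^sub>F x in nhds e. \<bar>T (P x) / S (P x)\<bar> < \<epsilon>"
      by (rule order_tendstoD(2)) (simp add: \<epsilon>)
    moreover have "\<forall>\<^sub>F x in nhds e. S (P x) > 0"
      by (rule order_tendstoD(1)[OF lim(1)]) simp
    ultimately have "\<forall>\<^sub>F x in nhds e. S (P x) > 0 \<and> \<bar>T (P x) / S (P x)\<bar> < \<epsilon>"
      by eventually_elim simp
    then show thesis using that by (auto simp: eventually_nhds_metric)
  qed
  \<comment> \<open>Every zero \<open>z\<close> of \<open>f\<close> near the pole lies on the cone
    over \<open>\<gamma>\<close>: \<open>P z\<close> is a positive multiple of a point of the
    segment, and by homogeneity and injectivity \<open>z\<close> is the \<open>m\<close>-th root of
    that factor times a point of \<open>\<gamma>\<close>. Hence each sector contains a point of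
    \<open>\<zeta>\<close>.\<close>
  have zero: "\<exists>t. \<bar>t\<bar> < \<epsilon> \<and> t \<noteq> 0 \<and> real j * pi / real k < Arg2pi (\<zeta> t) \<and> Arg2pi (\<zeta> t) < real (j + 1) * pi / real k"
    if j: "j \<le> 2" for j
  proof -
    define r where "r = min \<rho> \<delta> / 2"
    have r: "0 < r" "r < \<rho>" "r < \<delta>" using \<rho> \<delta> by (auto simp: r_def)
    obtain \<theta> where \<theta>: "real j * pi / real k < \<theta>" "\<theta> < real (j + 1) * pi / real k"
      and fz: "f (polar_point r (\<theta>0 + \<theta>)) = 0" using sectors[OF r(1,2) j] by blast
    define z where "z = polar_point r (\<theta>0 + \<theta>)"
    have "dist z e = r"
    proof -
      have "dist z e = sqrt ((r * cos (\<theta>0 + \<theta>))\<^sup>2 + (r * sin (\<theta>0 + \<theta>))\<^sup>2)"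
        by (simp add: z_def e polar_point_def dist_vec_def L2_set_def sum_3 vector_3 dist_real_def)
      also have "(r * cos (\<theta>0 + \<theta>))\<^sup>2 + (r * sin (\<theta>0 + \<theta>))\<^sup>2 = r\<^sup>2"
        by (simp add: power_mult_distrib flip: distrib_left)
      finally show ?thesis using r by simp
    qed
    then have S: "S (P z) > 0" and t: "\<bar>T (P z) / S (P z)\<bar> < \<epsilon>" using near r by auto
    let ?t = "T (P z) / S (P z)"
    have "P z = S (P z) *\<^sub>R p + T (P z) *\<^sub>R b"
      unfolding S_def T_def using plane_decomposition[OF ap, of "P z"] fz b by (simp add: b_def f_def z_def)
    then have "P z = S (P z) *\<^sub>R (p + ?t *\<^sub>R b)" using S by (simp add: scaleR_add_right)
    also have "\<dots> = P (root m (S (P z)) *\<^sub>R \<gamma> ?t)"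
      using S m by (simp add: homogeneous_harmonic_polynomial_map_scaleR[OF P] P\<gamma>[OF t] real_root_pow_pos2)
    finally have z: "z = root m (S (P z)) *\<^sub>R \<gamma> ?t" using inj by (simp add: inj_eq)
    have root: "root m (S (P z)) > 0" using S m by simp
    have \<gamma>z: "\<gamma> ?t = (1 / root m (S (P z))) *\<^sub>R polar_point r (\<theta>0 + \<theta>)"
      unfolding z_def[symmetric] by (subst (3) z) (use root in simp)
    have \<theta>_pos: "0 < \<theta>" using \<theta>(1) by (smt (verit) divide_nonneg_nonneg mult_nonneg_nonneg of_nat_0_le_iff pi_ge_zero)
    \<comment> \<open>Since \<open>j \<le> 2\<close> and \<open>k \<ge> 2\<close>, the three sectors
      stay below a full turn, so \<open>Arg2pi\<close> returns \<open>\<theta>\<close>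
      itself.\<close>
    have "real (j + 1) * pi / real k \<le> 3 * pi / 2"
      using j k by (intro frac_le mult_right_mono) auto
    then have \<theta>_less: "\<theta> < 2 * pi" using \<theta>(2) pi_gt_zero by linarith
    have arg: "Arg2pi (\<zeta> ?t) = \<theta>"
      unfolding \<zeta>_def by (rule Arg2pi_polar_point[OF \<gamma>z _ r(1) \<theta>_pos \<theta>_less]) (use root in simp)
    \<comment> \<open>The curve passes through the origin at parameter 0, where
      \<open>Arg2pi\<close> has the value 0 and not the positive angle
      \<open>\<theta>\<close>.\<close>
    moreover have "?t \<noteq> 0" using arg \<theta>_pos \<zeta>0 by (metis Arg2pi_0 less_irrefl)
    ultimately show ?thesis using \<theta> t by blast
  qed
  obtain t1 t2 t3 where "\<bar>t1\<bar> < \<epsilon>" "t1 \<noteq> 0" "\<bar>t2\<bar> < \<epsilon>" "t2 \<noteq> 0" "\<bar>t3\<bar> < \<epsilon>" "t3 \<noteq> 0"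
    "Arg2pi (\<zeta> t1) < real 1 * pi / real k" "real 1 * pi / real k < Arg2pi (\<zeta> t2)"
    "Arg2pi (\<zeta> t2) < real 2 * pi / real k" "real 2 * pi / real k < Arg2pi (\<zeta> t3)"
    using zero[of 0] zero[of 1] zero[of 2] by (auto simp: numeral_2_eq_2)
  moreover have "Arg2pi (\<zeta> t) \<notin> {0, real 1 * pi / real k, real 2 * pi / real k}" if "\<bar>t\<bar> < \<epsilon>" "t \<noteq> 0" for t
    using avoid[OF that, of 0] avoid[OF that, of 1] avoid[OF that, of 2] by simp
  ultimately show False
    using curve_meets_two_sectors_only[OF cont\<zeta>] by blast
qed

theorem theorem1p3:
  fixes m :: nat
  assumes "m > 1"
  shows "\<not> (\<exists>P :: real ^ 3 \<Rightarrow> real ^ 3. homogeneous_harmonic_polynomial_map m P \<and> inj P)"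
proof (rule notI, elim exE conjE)
  fix P :: "real ^ 3 \<Rightarrow> real ^ 3"
  assume P: "homogeneous_harmonic_polynomial_map m P" and inj: "inj P"
  obtain x where x: "norm x = 1" "det (jacobian_matrix P x) = 0"
    using det_jacobian_vanishes[OF assms P] .
  obtain R :: "real ^ 3 ^ 3" where R: "orthogonal_matrix R" "det R = 1" "R *v vector [0, 0, 1] = x"
    using rotation_to_pole[OF x(1)] .
  \<comment> \<open>The composition with the rotation is again harmonic and injective, and the zero
    of its Jacobian determinant now sits at the pole.\<close>
  have "det (jacobian_matrix (\<lambda>x. P (R *v x)) (vector [0, 0, 1])) = 0"
    by (simp add: jacobian_matrix_compose[OF P] det_mul R x(2))
  then have "\<not> inj (\<lambda>x. P (R *v x))"
    using assms homogeneous_harmonic_polynomial_map_compose_orthogonal[OF P R(1)]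
    by (intro not_inj_if_det_jacobian_pole_eq_0)
  moreover have "inj ((*v) R)"
  proof (rule injI)
    fix y z assume "R *v y = R *v z"
    then have "norm (R *v (y - z)) = 0" by (simp add: matrix_vector_mult_diff_distrib)
    then show "y = z" by (simp add: orthogonal_matrix_norm[OF R(1)])
  qed
  then have "inj (\<lambda>x. P (R *v x))"
    using inj_compose[OF inj] by (simp add: o_def)
  ultimately show False by contradiction
qed

end
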